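(* A space $X$ is realcompact if and only if $X$ is $\delta$-complete and there is no open partition of $X$ having Ulam-measurable cardinal.
   Context: All spaces are Tychonoff. $X$ is realcompact if it is homeomorphic to a closed subspace of a product of real lines. The fine uniformity $\mathtt u$ of $X$ is the finest (Hausdorff, covering) uniformity compatible with the topology of $X$. A cover is star-finite if each of its members meets at most finitely many of its members. $s_f\mathtt u$ is the uniformity on $X$ having as a base all star-finite open covers belonging to $\mathtt u$. $X$ is $\delta$-complete if $(X,s_f\mathtt u)$ is complete. An open partition is a partition of $X$ into open sets. An infinite cardinal $\kappa$ is Ulam-measurable if on a set of cardinal $\kappa$ there is a free ultrafilter with the countable intersection property (every countable subfamily has nonempty intersection). *)

theory Defs
  imports "HOL-Analysis.Analysis"
begin

unbundle cardinal_syntax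

section \<open>Tychonoff and realcompact spaces\<close>

definition Tychonoff_space :: "'a topology \<Rightarrow> bool" where
  "Tychonoff_space X \<longleftrightarrow> completely_regular_space X \<and> Hausdorff_space X"

text \<open>
  HOL cannot quantify over the type of the indices of the product inside a definition, so the
  index set is taken to be a set of functions \<open>'a \<Rightarrow> real\<close>. This loses nothing: lemma
  \<open>realcompact_space_any_index\<close> below shows that an arbitrary index set of an arbitrary
  type yields a realcompact space in the sense of this definition.
\<close>

definition realcompact_space :: "'a topology \<Rightarrow> bool" where
  "realcompact_space X \<longleftrightarrow>
     (\<exists>(I :: ('a \<Rightarrow> real) set) C. closedin (product_topology (\<lambda>_. euclideanreal) I) C \<and>
        X homeomorphic_space subtopology (product_topology (\<lambda>_. euclideanreal) I) C)"

lemma realcompact_space_any_index: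
  fixes X :: "'a topology" and I :: "'i set"
  assumes C: "closedin (product_topology (\<lambda>_. euclideanreal) I) C"
    and hom: "X homeomorphic_space subtopology (product_topology (\<lambda>_. euclideanreal) I) C"
  shows "realcompact_space X"
proof -
  let ?P = "product_topology (\<lambda>_. euclideanreal) I"
  obtain h g where hg: "homeomorphic_maps X (subtopology ?P C) h g"
    using hom unfolding homeomorphic_space_def by blast
  have h: "continuous_map X ?P h" and hC: "\<And>x. x \<in> topspace X \<Longrightarrow> h x \<in> C"
    and g: "continuous_map (subtopology ?P C) X g"
    and gh: "\<And>x. x \<in> topspace X \<Longrightarrow> g (h x) = x"
    and hg': "\<And>y. y \<in> topspace ?P \<Longrightarrow> y \<in> C \<Longrightarrow> h (g y) = y"
    using hg unfolding homeomorphic_maps_def by (auto simp: continuous_map_in_subtopology)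
  have Csub: "C \<subseteq> topspace ?P" using C closedin_subset by blast
  define p where "p = (\<lambda>i. \<lambda>x. h x i)"
  define J where "J = p ` I"
  let ?Q = "product_topology (\<lambda>_. euclideanreal) J :: (('a \<Rightarrow> real) \<Rightarrow> real) topology"
  define e where "e = (\<lambda>x. restrict (\<lambda>j :: 'a \<Rightarrow> real. j x) J)"
  define q where "q = (\<lambda>y :: ('a \<Rightarrow> real) \<Rightarrow> real. restrict (\<lambda>i. y (p i)) I)"
  have q: "continuous_map ?Q ?P q"
    unfolding q_def J_def
    by (auto simp: continuous_map_componentwise intro!: continuous_map_product_projection)
  have e: "continuous_map X ?Q e"
    unfolding e_def J_def using h
    by (auto simp: continuous_map_componentwise p_def)
  define D where "D = {y \<in> topspace ?Q. q y \<in> C}"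
  have D: "closedin ?Q D"
    unfolding D_def using closedin_continuous_map_preimage[OF q C] by simp
  have qe: "q (e x) = h x" if "x \<in> topspace X" for x
  proof -
    have "h x \<in> extensional I"
      using hC[OF that] Csub by (auto simp: PiE_def)
    then show ?thesis
      by (auto simp: q_def e_def J_def p_def extensional_def)
  qed
  have eq: "e (g (q y)) = y" if "y \<in> D" for y
  proof -
    have qC: "q y \<in> C" and yQ: "y \<in> topspace ?Q" using that by (auto simp: D_def)
    have "h (g (q y)) = q y" using hg' qC Csub by blast
    then have "h (g (q y)) i = y (p i)" if "i \<in> I" for i
      using that by (simp add: q_def)
    then show ?thesis
      using yQ by (intro ext) (auto simp: e_def J_def p_def PiE_def extensional_def)
  qed
  have "homeomorphic_maps X (subtopology ?Q D) e (g \<circ> q)"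
    unfolding homeomorphic_maps_def
  proof (intro conjI ballI)
    have "e x \<in> D" if "x \<in> topspace X" for x
      using that qe hC continuous_map_funspace[OF e] by (auto simp: D_def Pi_iff)
    then show "continuous_map X (subtopology ?Q D) e"
      using e by (auto simp: continuous_map_in_subtopology)
    have "continuous_map (subtopology ?Q D) (subtopology ?P C) q"
      using q by (auto simp: continuous_map_in_subtopology D_def continuous_map_from_subtopology)
    then show "continuous_map (subtopology ?Q D) X (g \<circ> q)"
      using g continuous_map_compose by blast
  qed (use qe gh eq in auto)
  then show ?thesis
    unfolding realcompact_space_def homeomorphic_space_def using D by blast
qed

section \<open>Covering uniformities\<close>

definition cover_of :: "'a set \<Rightarrow> 'a set set \<Rightarrow> bool" where
  "cover_of S C \<longleftrightarrow> C \<subseteq> Pow S \<and> \<Union>C = S"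

definition star :: "'a set \<Rightarrow> 'a set set \<Rightarrow> 'a set" where
  "star A C = \<Union>{B \<in> C. B \<inter> A \<noteq> {}}"

definition cover_refines :: "'a set set \<Rightarrow> 'a set set \<Rightarrow> bool" where
  "cover_refines C D \<longleftrightarrow> (\<forall>A\<in>C. \<exists>B\<in>D. A \<subseteq> B)"

definition star_refines :: "'a set set \<Rightarrow> 'a set set \<Rightarrow> bool" where
  "star_refines C D \<longleftrightarrow> (\<forall>A\<in>C. \<exists>B\<in>D. star A C \<subseteq> B)"

text \<open>Uniformities in the sense of Tukey and Isbell; the last clause is the Hausdorff condition.\<close>

definition covering_uniformity :: "'a set \<Rightarrow> 'a set set set \<Rightarrow> bool" where
  "covering_uniformity S \<mu> \<longleftrightarrow>
     \<mu> \<noteq> {} \<and>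
     (\<forall>C\<in>\<mu>. cover_of S C) \<and>
     (\<forall>C\<in>\<mu>. \<forall>D. cover_of S D \<and> cover_refines C D \<longrightarrow> D \<in> \<mu>) \<and>
     (\<forall>C\<in>\<mu>. \<forall>D\<in>\<mu>. \<exists>E\<in>\<mu>. star_refines E C \<and> star_refines E D) \<and>
     (\<forall>x\<in>S. \<forall>y\<in>S. x \<noteq> y \<longrightarrow> (\<exists>C\<in>\<mu>. y \<notin> star {x} C))"

definition uniform_topology :: "'a set \<Rightarrow> 'a set set set \<Rightarrow> 'a topology" where
  "uniform_topology S \<mu> = topology (\<lambda>G. G \<subseteq> S \<and> (\<forall>x\<in>G. \<exists>C\<in>\<mu>. star {x} C \<subseteq> G))"

definition compatible_uniformity :: "'a topology \<Rightarrow> 'a set set set \<Rightarrow> bool" where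
  "compatible_uniformity X \<mu> \<longleftrightarrow>
     covering_uniformity (topspace X) \<mu> \<and> uniform_topology (topspace X) \<mu> = X"

text \<open>A finer uniformity has more covers, so the finest one is the greatest with respect to inclusion.\<close>

definition fine_uniformity :: "'a topology \<Rightarrow> 'a set set set" where
  "fine_uniformity X = (GREATEST \<mu>. compatible_uniformity X \<mu>)"

definition star_finite :: "'a set set \<Rightarrow> bool" where
  "star_finite C \<longleftrightarrow> (\<forall>A\<in>C. finite {B \<in> C. B \<inter> A \<noteq> {}})"

text \<open>
  The covers having a refinement among the star-finite open members of \<open>\<mu>\<close>, that is, the
  uniformity of which these members form a base.
\<close>

definition star_finite_uniformity :: "'a topology \<Rightarrow> 'a set set set \<Rightarrow> 'a set set set" where
  "star_finite_uniformity X \<mu> =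
     {D. cover_of (topspace X) D \<and>
         (\<exists>C\<in>\<mu>. star_finite C \<and> (\<forall>A\<in>C. openin X A) \<and> cover_refines C D)}"

section \<open>Completeness\<close>

text \<open>The set \<open>A\<close> belongs to the filter \<open>F\<close> iff \<open>\<forall>\<^sub>F x in F. x \<in> A\<close>.\<close>

definition Cauchy_filter_on :: "'a set \<Rightarrow> 'a set set set \<Rightarrow> 'a filter \<Rightarrow> bool" where
  "Cauchy_filter_on S \<mu> F \<longleftrightarrow>
     F \<noteq> bot \<and> F \<le> principal S \<and> (\<forall>C\<in>\<mu>. \<exists>A\<in>C. \<forall>\<^sub>F x in F. x \<in> A)"

definition complete_uniformity :: "'a set \<Rightarrow> 'a set set set \<Rightarrow> bool" where
  "complete_uniformity S \<mu> \<longleftrightarrow>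
     (\<forall>F. Cauchy_filter_on S \<mu> F \<longrightarrow> (\<exists>x\<in>S. limitin (uniform_topology S \<mu>) (\<lambda>y. y) x F))"

definition delta_complete :: "'a topology \<Rightarrow> bool" where
  "delta_complete X \<longleftrightarrow>
     complete_uniformity (topspace X) (star_finite_uniformity X (fine_uniformity X))"

section \<open>Open partitions and Ulam-measurable cardinals\<close>

definition open_partition :: "'a topology \<Rightarrow> 'a set set \<Rightarrow> bool" where
  "open_partition X P \<longleftrightarrow> partition_on (topspace X) P \<and> (\<forall>A\<in>P. openin X A)"

definition ultrafilter_on :: "'a set \<Rightarrow> 'a set set \<Rightarrow> bool" where
  "ultrafilter_on S U \<longleftrightarrow>
     U \<subseteq> Pow S \<and> S \<in> U \<and> {} \<notin> U \<and>
     (\<forall>A\<in>U. \<forall>B\<in>U. A \<inter> B \<in> U) \<and>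
     (\<forall>A\<in>U. \<forall>B. A \<subseteq> B \<and> B \<subseteq> S \<longrightarrow> B \<in> U) \<and>
     (\<forall>A. A \<subseteq> S \<longrightarrow> A \<in> U \<or> S - A \<in> U)"

definition countable_intersection_property :: "'a set set \<Rightarrow> bool" where
  "countable_intersection_property U \<longleftrightarrow> (\<forall>V. V \<subseteq> U \<and> countable V \<longrightarrow> \<Inter>V \<noteq> {})"

definition Ulam_measurable :: "'a rel \<Rightarrow> bool" where
  "Ulam_measurable \<kappa> \<longleftrightarrow>
     Cinfinite \<kappa> \<and>
     (\<exists>(S :: 'a set) U. |S| =o \<kappa> \<and>
        ultrafilter_on S U \<and> \<Inter>U = {} \<and> countable_intersection_property U)"

end

theory Submission
  imports Defs
begin

text \<open>
  Call a proper filter \<open>F\<close> on \<open>X\<close> functionally convergent if \<open>f\<close> has a limit along \<open>F\<close> for every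
  continuous \<open>f : X \<rightarrow> \<real>\<close>. A Tychonoff space is realcompact iff each such filter converges in it:
  the filter yields a point of the ambient product of lines, and the limits of these filters are
  what has to lie in \<open>X\<close> for its image in the product indexed by all continuous functions to be
  closed. The theorem thus compares functionally convergent filters with the Cauchy filters of the
  uniformity with the star-finite open uniform covers as a base.

  Each Cauchy filter is functionally convergent, because the preimages under \<open>f\<close> of the intervals
  \<open>((k-1)\<epsilon>, (k+1)\<epsilon>)\<close> form a star-finite open cover that belongs to the fine uniformity. So
  realcompact spaces are \<open>\<delta>\<close>-complete. If a realcompact space had an open partition of
  Ulam-measurable cardinal, one would choose a point in each piece and transport the countably
  complete free ultrafilter to these points. Real functions converge along such an ultrafilter,
  hence it converges to a point of \<open>X\<close>; the piece of this point contains only one of the chosen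
  points, against freeness.

  For the converse let \<open>F\<close> be functionally convergent, let \<open>C\<close> be a star-finite open cover in the
  fine uniformity, and suppose that no open partition has Ulam-measurable cardinal. The chains of
  consecutively intersecting members of \<open>C\<close> decompose \<open>X\<close> into open pieces, each a union of
  countably many members. The families of pieces whose union is in \<open>F\<close> form an ultrafilter on the
  set of pieces, with the countable intersection property because functions that are constant on
  the pieces are continuous. It is therefore not free, and some piece \<open>Q\<close> is in \<open>F\<close>. Let
  \<open>A 0, A 1, \<dots>\<close> be the members of \<open>C\<close> in \<open>Q\<close>. As \<open>C\<close> is a uniform cover, there are continuous
  \<open>g n \<ge> 0\<close> that vanish off \<open>A n\<close>, such that at every point of \<open>Q\<close> some \<open>g n\<close> is \<open>1\<close>. If all
  \<open>g n\<close> tended to \<open>0\<close> along \<open>F\<close>, the continuous function \<open>\<Sum>n. n * g n\<close> would tend to infinity;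
  so some \<open>g n\<close> has a positive limit, and then \<open>A n\<close> is in \<open>F\<close>. Hence \<open>F\<close> is Cauchy
  (\<open>functionally_convergent_imp_Cauchy\<close>).

  The fine uniformity is handled through its description by normal covers, those refined by the
  first term of a sequence of covers whose stars are neighbourhoods and each of which star-refines
  the previous one
  (\<open>fine_uniformity_eq_normal_covers\<close>).
\<close>

section \<open>Stars and refinements\<close>

lemma mem_star_iff: "y \<in> star A C \<longleftrightarrow> (\<exists>B\<in>C. y \<in> B \<and> B \<inter> A \<noteq> {})"
  by (auto simp: star_def)

lemma mem_star_singleton_iff: "y \<in> star {x} C \<longleftrightarrow> (\<exists>B\<in>C. x \<in> B \<and> y \<in> B)"
  by (auto simp: star_def)

lemma star_mono: "A \<subseteq> B \<Longrightarrow> star A C \<subseteq> star B C"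
  by (auto simp: star_def)

lemma star_singleton_mono:
  assumes "cover_refines C D"
  shows "star {x} C \<subseteq> star {x} D"
proof
  fix y assume "y \<in> star {x} C"
  then obtain A where "A \<in> C" "x \<in> A" "y \<in> A"
    unfolding mem_star_singleton_iff by blast
  moreover then obtain B where "B \<in> D" "A \<subseteq> B"
    using assms unfolding cover_refines_def by blast
  ultimately show "y \<in> star {x} D"
    unfolding mem_star_singleton_iff by blast
qed

lemma star_refines_imp_cover_refines:
  assumes "star_refines C D"
  shows "cover_refines C D"
  unfolding cover_refines_def
proof
  fix A assume "A \<in> C"
  then obtain B where B: "B \<in> D" "star A C \<subseteq> B"
    using assms by (auto simp: star_refines_def)
  have "A \<subseteq> star A C"
    using \<open>A \<in> C\<close> unfolding star_def by blast
  with B show "\<exists>B\<in>D. A \<subseteq> B" by blast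
qed

lemma cover_refines_trans: "cover_refines C D \<Longrightarrow> cover_refines D E \<Longrightarrow> cover_refines C E"
  unfolding cover_refines_def by (meson subset_trans)

lemma star_refines_cover_refines_trans:
  "star_refines C D \<Longrightarrow> cover_refines D E \<Longrightarrow> star_refines C E"
  unfolding cover_refines_def star_refines_def by (meson subset_trans)

text \<open>
  Two steps along a star refinement stay within one step along the original cover. The separating
  functions below are interpolated with this fact.
\<close>

lemma star_star_subset:
  assumes "star_refines C D"
  shows "star (star A C) C \<subseteq> star A D"
proof
  fix y assume "y \<in> star (star A C) C"
  then obtain B z where Bz: "B \<in> C" "y \<in> B" "z \<in> B" "z \<in> star A C"
    unfolding mem_star_iff[of y] by blast
  then obtain B' where B: "B \<in> C" "y \<in> B" "z \<in> B" "B' \<in> C" "z \<in> B'" "B' \<inter> A \<noteq> {}"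
    unfolding mem_star_iff by blast
  obtain E where "E \<in> D" "star B' C \<subseteq> E"
    using assms \<open>B' \<in> C\<close> by (auto simp: star_refines_def)
  moreover have "y \<in> star B' C" "B' \<subseteq> star B' C"
    using B unfolding star_def by blast+
  ultimately have "y \<in> E" "E \<inter> A \<noteq> {}"
    using B(6) by auto
  with \<open>E \<in> D\<close> show "y \<in> star A D"
    unfolding mem_star_iff by blast
qed

section \<open>The fine uniformity\<close>

text \<open>
  Covers whose stars are neighbourhoods. The members of a uniform cover need not be open, but the
  stars of its points are neighbourhoods of these points.
\<close>

definition nbhd_cover :: "'a topology \<Rightarrow> 'a set set \<Rightarrow> bool" where
  "nbhd_cover X C \<longleftrightarrow> cover_of (topspace X) C \<and>
     (\<forall>x\<in>topspace X. \<exists>U. openin X U \<and> x \<in> U \<and> U \<subseteq> star {x} C)"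

text \<open>
  The terms are not required to be open, so that every sequence of successive star refinements in
  a compatible uniformity is normal without passing to interiors.
\<close>

definition normal_sequence :: "'a topology \<Rightarrow> (nat \<Rightarrow> 'a set set) \<Rightarrow> bool" where
  "normal_sequence X V \<longleftrightarrow> (\<forall>n. nbhd_cover X (V n) \<and> star_refines (V (Suc n)) (V n))"

text \<open>
  The normal covers in the sense of Tukey; they turn out to be the members of the fine uniformity.
\<close>

definition normal_covers :: "'a topology \<Rightarrow> 'a set set set" where
  "normal_covers X =
     {D. cover_of (topspace X) D \<and> (\<exists>V. normal_sequence X V \<and> cover_refines (V 0) D)}"

lemma normal_sequence_Suc: "normal_sequence X V \<Longrightarrow> normal_sequence X (\<lambda>n. V (Suc n))"
  by (simp add: normal_sequence_def)

lemma normal_sequence_in_normal_covers: "normal_sequence X V \<Longrightarrow> V 0 \<in> normal_covers X"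
  unfolding normal_covers_def normal_sequence_def nbhd_cover_def cover_refines_def by blast

lemma open_cover_imp_nbhd_cover:
  assumes "cover_of (topspace X) C" "\<And>A. A \<in> C \<Longrightarrow> openin X A"
  shows "nbhd_cover X C"
  unfolding nbhd_cover_def
proof (intro conjI ballI)
  fix x assume "x \<in> topspace X"
  then obtain A where "A \<in> C" "x \<in> A"
    using assms(1) unfolding cover_of_def by blast
  then show "\<exists>U. openin X U \<and> x \<in> U \<and> U \<subseteq> star {x} C"
    using assms(2) by (intro exI[of _ A]) (auto simp: mem_star_singleton_iff)
qed (fact assms)

lemma cover_of_common_refinement:
  assumes "cover_of S C" "cover_of S D"
  shows "cover_of S {A \<inter> B |A B. A \<in> C \<and> B \<in> D}"
proof -
  have "S \<subseteq> \<Union>{A \<inter> B |A B. A \<in> C \<and> B \<in> D}"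
  proof
    fix x assume "x \<in> S"
    then have "x \<in> \<Union>C" "x \<in> \<Union>D"
      using assms by (simp_all add: cover_of_def)
    then obtain A B where "A \<in> C" "x \<in> A" "B \<in> D" "x \<in> B"
      by (elim UnionE)
    then show "x \<in> \<Union>{A \<inter> B |A B. A \<in> C \<and> B \<in> D}"
      by (intro UnionI[of "A \<inter> B"]) auto
  qed
  moreover have "C \<subseteq> Pow S"
    using assms(1) by (simp add: cover_of_def)
  then have "{A \<inter> B |A B. A \<in> C \<and> B \<in> D} \<subseteq> Pow S" "\<Union>{A \<inter> B |A B. A \<in> C \<and> B \<in> D} \<subseteq> S"
    by blast+
  ultimately show ?thesis
    unfolding cover_of_def by (intro conjI subset_antisym)
qed

lemma nbhd_cover_common_refinement:
  assumes "nbhd_cover X C" "nbhd_cover X D"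
  shows "nbhd_cover X {A \<inter> B |A B. A \<in> C \<and> B \<in> D}" (is "nbhd_cover X ?E")
  unfolding nbhd_cover_def
proof (intro conjI ballI)
  show "cover_of (topspace X) ?E"
    using assms by (intro cover_of_common_refinement) (auto simp: nbhd_cover_def)
  fix x assume "x \<in> topspace X"
  then obtain U W where "openin X U" "x \<in> U" "U \<subseteq> star {x} C" "openin X W" "x \<in> W" "W \<subseteq> star {x} D"
    using assms unfolding nbhd_cover_def by metis
  moreover have "star {x} C \<inter> star {x} D \<subseteq> star {x} ?E"
    unfolding star_def by blast
  ultimately show "\<exists>U. openin X U \<and> x \<in> U \<and> U \<subseteq> star {x} ?E"
    by (intro exI[of _ "U \<inter> W"]) auto
qed

lemma star_refines_common_refinement:
  assumes "star_refines C C'" "star_refines D D'"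
  shows "star_refines {A \<inter> B |A B. A \<in> C \<and> B \<in> D} {A \<inter> B |A B. A \<in> C' \<and> B \<in> D'}"
  unfolding star_refines_def
proof clarify
  fix A B assume "A \<in> C" "B \<in> D"
  then obtain A' B' where "A' \<in> C'" "star A C \<subseteq> A'" "B' \<in> D'" "star B D \<subseteq> B'"
    using assms by (meson star_refines_def)
  moreover have "star (A \<inter> B) {A \<inter> B |A B. A \<in> C \<and> B \<in> D} \<subseteq> star A C \<inter> star B D"
    unfolding star_def by blast
  ultimately show "\<exists>E\<in>{A \<inter> B |A B. A \<in> C' \<and> B \<in> D'}. star (A \<inter> B) {A \<inter> B |A B. A \<in> C \<and> B \<in> D} \<subseteq> E"
    by (intro bexI[of _ "A' \<inter> B'"]) blast+
qed

lemma normal_sequence_common_refinement: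
  assumes "normal_sequence X V" "normal_sequence X W"
  shows "normal_sequence X (\<lambda>n. {A \<inter> B |A B. A \<in> V n \<and> B \<in> W n})"
  using assms unfolding normal_sequence_def
  by (auto intro!: nbhd_cover_common_refinement star_refines_common_refinement)

text \<open>
  The preimages under \<open>f\<close> of the intervals \<open>((k-1)e, (k+1)e)\<close> with \<open>k\<close> an integer. The centres are
  discrete, which makes the cover star-finite, and the overlap makes it normal.
\<close>

definition interval_cover :: "'a topology \<Rightarrow> ('a \<Rightarrow> real) \<Rightarrow> real \<Rightarrow> 'a set set" where
  "interval_cover X f e = range (\<lambda>k::int. {y \<in> topspace X. \<bar>f y - of_int k * e\<bar> < e})"

lemma openin_abs_less:
  assumes "continuous_map X euclideanreal f"
  shows "openin X {y \<in> topspace X. \<bar>f y - r\<bar> < e}"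
proof -
  have "openin X {y \<in> topspace X. f y \<in> ball r e}"
    using openin_continuous_map_preimage[OF assms, of "ball r e"] by simp
  then show ?thesis
    by (simp add: dist_real_def abs_minus_commute)
qed

lemma interval_cover_open:
  assumes "continuous_map X euclideanreal f" "A \<in> interval_cover X f e"
  shows "openin X A"
  using assms openin_abs_less by (auto simp: interval_cover_def)

lemma nearest_multiple:
  assumes "(e::real) > 0"
  obtains k :: int where "\<bar>t - of_int k * e\<bar> \<le> e/2"
proof
  have "\<bar>of_int (round (t / e)) - t / e\<bar> \<le> 1/2"
    by (rule of_int_round_abs_le)
  then have "\<bar>of_int (round (t / e)) - t / e\<bar> * e \<le> 1/2 * e"
    using assms by (intro mult_right_mono) auto
  then have "\<bar>(of_int (round (t / e)) - t / e) * e\<bar> \<le> 1/2 * e"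
    using assms by (simp add: abs_mult)
  then show "\<bar>t - of_int (round (t / e)) * e\<bar> \<le> e/2"
    using assms by (simp add: algebra_simps abs_minus_commute)
qed

lemma cover_of_interval_cover:
  assumes "e > 0"
  shows "cover_of (topspace X) (interval_cover X f e)"
proof -
  have "\<exists>k::int. \<bar>f y - of_int k * e\<bar> < e" for y
    using nearest_multiple[OF assms, of "f y"] assms
    by (metis field_sum_of_halves less_add_same_cancel1 half_gt_zero order_le_less_trans)
  then show ?thesis
    by (auto simp: cover_of_def interval_cover_def)
qed

lemma star_finite_interval_cover:
  assumes "e > 0"
  shows "star_finite (interval_cover X f e)"
  unfolding star_finite_def
proof
  let ?J = "\<lambda>k::int. {y \<in> topspace X. \<bar>f y - of_int k * e\<bar> < e}"
  fix A assume "A \<in> interval_cover X f e"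
  then obtain k where k: "A = ?J k"
    by (auto simp: interval_cover_def)
  have "l \<in> {k-1..k+1}" if "?J l \<inter> A \<noteq> {}" for l
  proof -
    from that obtain y where y: "\<bar>f y - of_int k * e\<bar> < e" "\<bar>f y - of_int l * e\<bar> < e"
      using k by auto
    then have "\<bar>of_int l * e - of_int k * e\<bar> < 2 * e"
      by arith
    then have "\<bar>of_int (l - k)\<bar> * e < 2 * e"
      using assms by (simp add: abs_mult flip: left_diff_distrib)
    then have "\<bar>l - k\<bar> < 2"
      using assms by (simp add: of_int_less_iff flip: of_int_abs of_int_diff)
    then show ?thesis by auto
  qed
  then have "{B \<in> interval_cover X f e. B \<inter> A \<noteq> {}} \<subseteq> ?J ` {k-1..k+1}"
    unfolding interval_cover_def by blast
  then show "finite {B \<in> interval_cover X f e. B \<inter> A \<noteq> {}}"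
    by (rule finite_subset) simp
qed

lemma interval_cover_normal:
  assumes f: "continuous_map X euclideanreal f" and "e > 0"
  shows "interval_cover X f e \<in> normal_covers X"
proof -
  \<comment> \<open>Preimages of all intervals of radius \<open>d n\<close>; three radii of one level fit into one of the previous level.\<close>
  define d where "d = (\<lambda>n. e / 2 / 4^n)"
  define V where "V = (\<lambda>n. range (\<lambda>r. {y \<in> topspace X. \<bar>f y - r\<bar> < d n}))"
  have d: "d n > 0" "4 * d (Suc n) = d n" for n
    using \<open>e > 0\<close> by (auto simp: d_def)
  have "nbhd_cover X (V n)" for n
  proof (rule open_cover_imp_nbhd_cover)
    have "\<exists>r. \<bar>f y - r\<bar> < d n" for y
      using d(1) by (intro exI[of _ "f y"]) simp
    then show "cover_of (topspace X) (V n)"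
      by (auto simp: cover_of_def V_def)
  qed (use openin_abs_less[OF f] in \<open>auto simp: V_def\<close>)
  moreover have "star_refines (V (Suc n)) (V n)" for n
    unfolding star_refines_def
  proof
    fix A assume "A \<in> V (Suc n)"
    then obtain r where r: "A = {y \<in> topspace X. \<bar>f y - r\<bar> < d (Suc n)}"
      by (auto simp: V_def)
    have "star A (V (Suc n)) \<subseteq> {y \<in> topspace X. \<bar>f y - r\<bar> < d n}"
    proof
      fix y assume "y \<in> star A (V (Suc n))"
      then obtain s z where "y \<in> topspace X" "\<bar>f y - s\<bar> < d (Suc n)"
         "\<bar>f z - s\<bar> < d (Suc n)" "\<bar>f z - r\<bar> < d (Suc n)"
        by (auto simp: mem_star_iff V_def r)
      then show "y \<in> {y \<in> topspace X. \<bar>f y - r\<bar> < d n}"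
        using d[of n] d(1)[of "Suc n"] by simp
    qed
    then show "\<exists>B\<in>V n. star A (V (Suc n)) \<subseteq> B"
      by (auto simp: V_def)
  qed
  ultimately have V: "normal_sequence X V"
    by (simp add: normal_sequence_def)
  have "cover_refines (V 0) (interval_cover X f e)"
    unfolding cover_refines_def
  proof
    fix A assume "A \<in> V 0"
    then obtain r where r: "A = {y \<in> topspace X. \<bar>f y - r\<bar> < e/2}"
      by (auto simp: V_def d_def)
    obtain k :: int where k: "\<bar>r - of_int k * e\<bar> \<le> e/2"
      using nearest_multiple[OF \<open>e > 0\<close>] by blast
    have "A \<subseteq> {y \<in> topspace X. \<bar>f y - of_int k * e\<bar> < e}"
    proof
      fix y assume "y \<in> A"
      then have "y \<in> topspace X" "\<bar>f y - r\<bar> < e/2"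
        using r by auto
      moreover from this k have "\<bar>f y - of_int k * e\<bar> < e"
        by linarith
      ultimately show "y \<in> {y \<in> topspace X. \<bar>f y - of_int k * e\<bar> < e}"
        by simp
    qed
    then show "\<exists>B\<in>interval_cover X f e. A \<subseteq> B"
      by (auto simp: interval_cover_def)
  qed
  then show ?thesis
    using V cover_of_interval_cover[OF \<open>e > 0\<close>] by (auto simp: normal_covers_def)
qed

lemma completely_regular_space_separation:
  assumes "completely_regular_space X" "openin X G" "x \<in> G"
  obtains f where "continuous_map X euclideanreal f" "f x = 0" "\<And>y. y \<in> topspace X \<Longrightarrow> y \<notin> G \<Longrightarrow> f y = 1"
proof -
  have "\<exists>f. continuous_map X euclideanreal f \<and> f x = 0 \<and> f ` (topspace X - G) \<subseteq> {1}"
    using assms unfolding completely_regular_space_alt' by simp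
  then obtain f where f: "continuous_map X euclideanreal f" "f x = 0" "f ` (topspace X - G) \<subseteq> {1}"
    by blast
  from f(3) have "f y = 1" if "y \<in> topspace X" "y \<notin> G" for y
    using that by auto
  with f(1,2) show thesis by (rule that)
qed

lemma interval_cover_star_subset:
  assumes "completely_regular_space X" "openin X G" "x \<in> G"
  obtains f where "continuous_map X euclideanreal f" "star {x} (interval_cover X f (1/2)) \<subseteq> G"
proof -
  obtain f where f: "continuous_map X euclideanreal f" "f x = 0" "\<And>y. y \<in> topspace X \<Longrightarrow> y \<notin> G \<Longrightarrow> f y = 1"
    using completely_regular_space_separation[OF assms] by blast
  have "star {x} (interval_cover X f (1/2)) \<subseteq> G"
  proof
    fix y assume "y \<in> star {x} (interval_cover X f (1/2))"
    then obtain k :: int where "y \<in> topspace X" 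
      "\<bar>f y - of_int k * (1/2)\<bar> < 1/2" "\<bar>f x - of_int k * (1/2)\<bar> < 1/2"
      by (auto simp: mem_star_singleton_iff interval_cover_def)
    then have "f y \<noteq> 1" "y \<in> topspace X"
      using f(2) by linarith+
    then show "y \<in> G"
      using f(3) by blast
  qed
  with f(1) show thesis by (rule that)
qed

lemma uniform_topology_eqI:
  assumes "\<And>G x. openin X G \<Longrightarrow> x \<in> G \<Longrightarrow> \<exists>C\<in>\<mu>. star {x} C \<subseteq> G"
    and "\<And>C. C \<in> \<mu> \<Longrightarrow> nbhd_cover X C"
  shows "uniform_topology (topspace X) \<mu> = X"
proof -
  have "G \<subseteq> topspace X \<and> (\<forall>x\<in>G. \<exists>C\<in>\<mu>. star {x} C \<subseteq> G) \<longleftrightarrow> openin X G" for G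
  proof
    assume G: "G \<subseteq> topspace X \<and> (\<forall>x\<in>G. \<exists>C\<in>\<mu>. star {x} C \<subseteq> G)"
    show "openin X G"
    proof (subst openin_subopen, intro ballI)
      fix x assume "x \<in> G"
      then obtain C where "C \<in> \<mu>" "star {x} C \<subseteq> G" "x \<in> topspace X" using G by blast
      then show "\<exists>T. openin X T \<and> x \<in> T \<and> T \<subseteq> G"
        using assms(2) unfolding nbhd_cover_def by (meson subset_trans)
    qed
  qed (use assms(1) openin_subset in blast)
  then show ?thesis
    unfolding uniform_topology_def by (simp add: openin_inverse)
qed

lemma nbhd_cover_refines:
  assumes "nbhd_cover X C" "cover_refines C D" "cover_of (topspace X) D"
  shows "nbhd_cover X D"
  using assms star_singleton_mono[OF assms(2)] unfolding nbhd_cover_def by (meson subset_trans)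

lemma normal_covers_nbhd_cover: "C \<in> normal_covers X \<Longrightarrow> nbhd_cover X C"
  unfolding normal_covers_def normal_sequence_def using nbhd_cover_refines by blast

lemma compatible_uniformity_normal_covers:
  assumes "Tychonoff_space X"
  shows "compatible_uniformity X (normal_covers X)"
proof -
  have cr: "completely_regular_space X" and T: "Hausdorff_space X"
    using assms by (auto simp: Tychonoff_space_def)
  have fine: "\<exists>C\<in>normal_covers X. star {x} C \<subseteq> G" if "openin X G" "x \<in> G" for G x
    using interval_cover_star_subset[OF cr that] interval_cover_normal
    by (metis half_gt_zero zero_less_one)
  have "covering_uniformity (topspace X) (normal_covers X)"
    unfolding covering_uniformity_def
  proof (intro conjI ballI allI impI)
    show "normal_covers X \<noteq> {}"
      using interval_cover_normal[of X "\<lambda>_. 0" 1] by auto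
    show "cover_of (topspace X) C" if "C \<in> normal_covers X" for C
      using that by (simp add: normal_covers_def)
    show "D \<in> normal_covers X"
      if "C \<in> normal_covers X" "cover_of (topspace X) D \<and> cover_refines C D" for C D
      using that by (auto simp: normal_covers_def intro: cover_refines_trans)
    show "\<exists>E\<in>normal_covers X. star_refines E C \<and> star_refines E D"
      if CD: "C \<in> normal_covers X" "D \<in> normal_covers X" for C D
    proof -
      obtain V W where V: "normal_sequence X V" "cover_refines (V 0) C"
        and W: "normal_sequence X W" "cover_refines (W 0) D"
        using CD unfolding normal_covers_def by blast
      let ?Z = "\<lambda>n. {A \<inter> B |A B. A \<in> V n \<and> B \<in> W n}"
      have Z: "normal_sequence X ?Z"
        using V W by (intro normal_sequence_common_refinement)
      then have "star_refines (?Z (Suc 0)) (?Z 0)"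
        unfolding normal_sequence_def by blast
      moreover have "cover_refines (?Z 0) (V 0)" "cover_refines (?Z 0) (W 0)"
        by (auto simp: cover_refines_def)
      ultimately have "star_refines (?Z (Suc 0)) C" "star_refines (?Z (Suc 0)) D"
        using V(2) W(2) by (meson star_refines_cover_refines_trans cover_refines_trans)+
      moreover have "?Z (Suc 0) \<in> normal_covers X"
        using normal_sequence_in_normal_covers[OF normal_sequence_Suc[OF Z]] .
      ultimately show ?thesis by blast
    qed
    show "\<exists>C\<in>normal_covers X. y \<notin> star {x} C"
      if "x \<in> topspace X" "y \<in> topspace X" "x \<noteq> y" for x y
    proof -
      obtain U V where "openin X U" "openin X V" "x \<in> U" "y \<in> V" "disjnt U V"
        using T \<open>x \<in> topspace X\<close> \<open>y \<in> topspace X\<close> \<open>x \<noteq> y\<close>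
        unfolding Hausdorff_space_def by blast
      then have "openin X U" "x \<in> U" "y \<notin> U"
        by (auto simp: disjnt_def)
      then show ?thesis using fine[of U x] by blast
    qed
  qed
  moreover have "uniform_topology (topspace X) (normal_covers X) = X"
    using fine normal_covers_nbhd_cover by (intro uniform_topology_eqI)
  ultimately show ?thesis
    by (simp add: compatible_uniformity_def)
qed

lemma openin_uniform_topology:
  assumes "covering_uniformity S \<mu>"
  shows "openin (uniform_topology S \<mu>) G \<longleftrightarrow> G \<subseteq> S \<and> (\<forall>x\<in>G. \<exists>C\<in>\<mu>. star {x} C \<subseteq> G)"
proof -
  have "istopology (\<lambda>G. G \<subseteq> S \<and> (\<forall>x\<in>G. \<exists>C\<in>\<mu>. star {x} C \<subseteq> G))"
    unfolding istopology_def
  proof (rule conjI; intro allI impI)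
    fix G H
    assume G: "G \<subseteq> S \<and> (\<forall>x\<in>G. \<exists>C\<in>\<mu>. star {x} C \<subseteq> G)"
      and H: "H \<subseteq> S \<and> (\<forall>x\<in>H. \<exists>C\<in>\<mu>. star {x} C \<subseteq> H)"
    have "\<exists>E\<in>\<mu>. star {x} E \<subseteq> G \<inter> H" if x: "x \<in> G \<inter> H" for x
    proof -
      obtain C D where CD: "C \<in> \<mu>" "star {x} C \<subseteq> G" "D \<in> \<mu>" "star {x} D \<subseteq> H"
        using G H x by blast
      then obtain E where "E \<in> \<mu>" "star_refines E C" "star_refines E D"
        using assms unfolding covering_uniformity_def by metis
      then show ?thesis
        using CD star_singleton_mono star_refines_imp_cover_refines by (meson le_inf_iff subset_trans)
    qed
    with G H show "G \<inter> H \<subseteq> S \<and> (\<forall>x\<in>G \<inter> H. \<exists>C\<in>\<mu>. star {x} C \<subseteq> G \<inter> H)"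
      by blast
  next
    fix K assume K: "\<forall>G\<in>K. G \<subseteq> S \<and> (\<forall>x\<in>G. \<exists>C\<in>\<mu>. star {x} C \<subseteq> G)"
    then show "\<Union>K \<subseteq> S \<and> (\<forall>x\<in>\<Union>K. \<exists>C\<in>\<mu>. star {x} C \<subseteq> \<Union>K)"
      by (meson Sup_least UnionE Union_upper subset_trans)
  qed
  then show ?thesis
    by (simp add: uniform_topology_def topology_inverse')
qed

lemma uniform_cover_nbhd_cover:
  assumes \<mu>: "covering_uniformity S \<mu>" and X: "uniform_topology S \<mu> = X" "topspace X = S"
    and C: "C \<in> \<mu>"
  shows "nbhd_cover X C"
  unfolding nbhd_cover_def
proof (intro conjI ballI)
  show cov: "cover_of (topspace X) C"
    using \<mu> C X by (simp add: covering_uniformity_def)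
  fix x assume x: "x \<in> topspace X"
  \<comment> \<open>The uniform interior of the star of \<open>x\<close>.\<close>
  define G where "G = {y \<in> S. \<exists>E\<in>\<mu>. star {y} E \<subseteq> star {x} C}"
  have "\<exists>E\<in>\<mu>. star {y} E \<subseteq> G" if "y \<in> G" for y
  proof -
    obtain E where E: "E \<in> \<mu>" "star {y} E \<subseteq> star {x} C"
      using \<open>y \<in> G\<close> by (auto simp: G_def)
    then obtain E' where E': "E' \<in> \<mu>" "star_refines E' E"
      using \<mu> unfolding covering_uniformity_def by meson
    have "z \<in> G" if "z \<in> star {y} E'" for z
    proof -
      have "{z} \<subseteq> star {y} E'" using that by simp
      then have "star {z} E' \<subseteq> star {y} E"
        using star_star_subset[OF E'(2), of "{y}"] star_mono by (meson subset_trans)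
      moreover have "z \<in> S"
        using that E'(1) \<mu> by (auto simp: mem_star_singleton_iff covering_uniformity_def cover_of_def)
      ultimately show ?thesis
        using E'(1) E(2) unfolding G_def by blast
    qed
    then show ?thesis using E'(1) by blast
  qed
  then have "openin X G"
    using openin_uniform_topology[OF \<mu>] X(1) by (auto simp: G_def)
  moreover have "x \<in> G"
    using x X C by (auto simp: G_def)
  moreover have "G \<subseteq> star {x} C"
  proof
    fix y assume "y \<in> G"
    then obtain E where E: "E \<in> \<mu>" "star {y} E \<subseteq> star {x} C" "y \<in> S"
      by (auto simp: G_def)
    then have "y \<in> star {y} E"
      using \<mu> by (auto simp: mem_star_singleton_iff covering_uniformity_def cover_of_def)
    with E show "y \<in> star {x} C" by blast
  qed
  ultimately show "\<exists>U. openin X U \<and> x \<in> U \<and> U \<subseteq> star {x} C" by blast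
qed

lemma compatible_uniformity_subset_normal_covers:
  assumes "compatible_uniformity X \<mu>"
  shows "\<mu> \<subseteq> normal_covers X"
proof
  have \<mu>: "covering_uniformity (topspace X) \<mu>" and top: "uniform_topology (topspace X) \<mu> = X"
    using assms by (auto simp: compatible_uniformity_def)
  have ref: "\<exists>E\<in>\<mu>. star_refines E C" if "C \<in> \<mu>" for C
    using \<mu> that unfolding covering_uniformity_def by meson
  fix D assume D: "D \<in> \<mu>"
  then obtain E where E: "E \<in> \<mu>" "star_refines E D" using ref by blast
  have "\<exists>V. \<forall>n. (V n \<in> \<mu> \<and> (n = 0 \<longrightarrow> V n = E)) \<and> star_refines (V (Suc n)) (V n)"
    by (rule dependent_nat_choice) (use E ref in auto)
  then obtain V where V: "\<And>n. V n \<in> \<mu>" "V 0 = E" "\<And>n. star_refines (V (Suc n)) (V n)"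
    by metis
  then have "normal_sequence X V"
    using uniform_cover_nbhd_cover[OF \<mu> top refl] by (simp add: normal_sequence_def)
  moreover have "cover_refines (V 0) D"
    using V(2) E(2) star_refines_imp_cover_refines by simp
  moreover have "cover_of (topspace X) D"
    using D \<mu> by (simp add: covering_uniformity_def)
  ultimately show "D \<in> normal_covers X"
    by (auto simp: normal_covers_def)
qed

theorem fine_uniformity_eq_normal_covers:
  assumes "Tychonoff_space X"
  shows "fine_uniformity X = normal_covers X"
  unfolding fine_uniformity_def
  by (rule Greatest_equality)
     (use compatible_uniformity_normal_covers[OF assms]
        compatible_uniformity_subset_normal_covers in auto)

lemma interval_cover_star_finite_uniformity:
  assumes "Tychonoff_space X" "continuous_map X euclideanreal f" "e > 0"
  shows "interval_cover X f e \<in> star_finite_uniformity X (fine_uniformity X)"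
  unfolding star_finite_uniformity_def fine_uniformity_eq_normal_covers[OF assms(1)]
proof (intro CollectI conjI bexI ballI)
  show "cover_refines (interval_cover X f e) (interval_cover X f e)"
    by (auto simp: cover_refines_def)
qed (use assms in \<open>auto simp: interval_cover_normal cover_of_interval_cover
       star_finite_interval_cover intro: interval_cover_open\<close>)

lemma uniform_topology_star_finite_uniformity:
  assumes "Tychonoff_space X"
  shows "uniform_topology (topspace X) (star_finite_uniformity X (fine_uniformity X)) = X"
proof (rule uniform_topology_eqI)
  fix G x assume "openin X G" "x \<in> G"
  then obtain f where f: "continuous_map X euclideanreal f"
      and sub: "star {x} (interval_cover X f (1/2)) \<subseteq> G"
    using interval_cover_star_subset assms unfolding Tychonoff_space_def by metis
  have "interval_cover X f (1/2) \<in> star_finite_uniformity X (fine_uniformity X)"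
    by (intro interval_cover_star_finite_uniformity assms f) simp
  with sub show "\<exists>C\<in>star_finite_uniformity X (fine_uniformity X). star {x} C \<subseteq> G" by blast
next
  fix C assume "C \<in> star_finite_uniformity X (fine_uniformity X)"
  then show "nbhd_cover X C"
    unfolding star_finite_uniformity_def fine_uniformity_eq_normal_covers[OF assms]
    using nbhd_cover_refines normal_covers_nbhd_cover by blast
qed

section \<open>Continuous functions subordinate to a normal cover\<close>

lemma dyadic_between:
  assumes "0 \<le> a" "a < b" "b \<le> (1::real)"
  obtains r where "r \<in> dyadics \<inter> {0..1}" "a < r" "r < b"
proof -
  obtain n q r where r: "real q / 2^n \<le> a" "a < real r / 2^n" "\<bar>real q / 2^n - real r / 2^n\<bar> < b - a"
    using padic_rational_approximation_straddle_pos_le[of "b - a" 2 a] assms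
    by (metis diff_gt_0_iff_gt one_less_numeral_iff semiring_norm(76))
  have "real r / 2^n \<in> dyadics"
    unfolding dyadics_def by auto
  moreover have "a < real r / 2^n" "real r / 2^n < b"
    using r by linarith+
  ultimately show thesis
    using assms by (intro that[of "real r / 2^n"]) (simp_all del: divide_le_eq_1_pos)
qed

text \<open>
  The construction in the proof of Urysohn's lemma, for an arbitrary family of sets indexed by the
  dyadic rationals of the unit interval instead of one obtained from normality.
\<close>

lemma continuous_map_dyadic_chain:
  fixes G :: "real \<Rightarrow> 'a set"
  assumes G: "\<And>r s. \<lbrakk>r \<in> dyadics \<inter> {0..1}; s \<in> dyadics \<inter> {0..1}; r < s\<rbrakk>
                \<Longrightarrow> G r \<subseteq> X interior_of (G s) \<and> X closure_of (G r) \<subseteq> G s"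
  obtains f :: "'a \<Rightarrow> real" where "continuous_map X euclideanreal f" "\<And>x. 0 \<le> f x" "\<And>x. f x \<le> 1"
    "\<And>x. x \<in> G 0 \<Longrightarrow> f x = 0" "\<And>x. x \<notin> G 1 \<Longrightarrow> f x = 1"
proof -
  define f where "f x = Inf (insert 1 {r \<in> dyadics \<inter> {0..1}. x \<in> G r})" for x
  have f0: "0 \<le> f x" for x
    unfolding f_def by (rule cInf_greatest) auto
  have bdd: "bdd_below (insert 1 {r \<in> dyadics \<inter> {0..1}. x \<in> G r})" for x
    by (rule bdd_belowI[of _ 0]) auto
  have f1: "f x \<le> 1" for x
    unfolding f_def by (rule cInf_lower[OF _ bdd]) auto
  have f_le: "f x \<le> r" if "r \<in> dyadics \<inter> {0..1}" "x \<in> G r" for x r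
    unfolding f_def by (rule cInf_lower[OF _ bdd]) (use that in auto)
  have le_f: "r \<le> f x" if r: "r \<in> dyadics \<inter> {0..1}" "x \<notin> G r" for x r
    unfolding f_def
  proof (rule cInf_greatest)
    fix s assume s: "s \<in> insert 1 {r \<in> dyadics \<inter> {0..1}. x \<in> G r}"
    show "r \<le> s"
    proof (rule ccontr)
      assume "\<not> r \<le> s"
      then have "s \<in> dyadics \<inter> {0..1}" "x \<in> G s" "s < r"
        using s r by auto
      then have "x \<in> G r"
        using G[of s r] r interior_of_subset[of X "G r"] by blast
      with r show False by simp
    qed
  qed simp
  have "openin X {x \<in> topspace X. f x < a}" for a
  proof (subst openin_subopen, intro ballI)
    fix x assume "x \<in> {x \<in> topspace X. f x < a}"
    then have x: "x \<in> topspace X" "f x < a" by auto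
    show "\<exists>T. openin X T \<and> x \<in> T \<and> T \<subseteq> {x \<in> topspace X. f x < a}"
    proof (cases "a > 1")
      case True
      then have "{x \<in> topspace X. f x < a} = topspace X"
        using f1 by (auto intro: order_le_less_trans)
      then show ?thesis using x by auto
    next
      case False
      obtain r where r: "r \<in> dyadics \<inter> {0..1}" "f x < r" "r < a"
        using dyadic_between[OF f0 x(2)] False by (metis linorder_not_le)
      obtain s where s: "s \<in> dyadics \<inter> {0..1}" "f x < s" "s < r"
        using dyadic_between[OF f0 r(2)] r(1) by (metis IntE atLeastAtMost_iff)
      have "x \<in> G s" using le_f[of s x] s by auto
      then have "x \<in> X interior_of (G r)"
        using G[of s r] s r by blast
      moreover have "X interior_of (G r) \<subseteq> {x \<in> topspace X. f x < a}"
      proof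
        fix y assume "y \<in> X interior_of (G r)"
        then have "y \<in> G r" "y \<in> topspace X"
          using interior_of_subset[of X "G r"] interior_of_subset_topspace[of X "G r"] by auto
        then show "y \<in> {x \<in> topspace X. f x < a}"
          using f_le[of r y] r by auto
      qed
      ultimately show ?thesis
        by (intro exI[of _ "X interior_of (G r)"]) simp
    qed
  qed
  moreover have "openin X {x \<in> topspace X. f x > a}" for a
  proof (subst openin_subopen, intro ballI)
    fix x assume "x \<in> {x \<in> topspace X. f x > a}"
    then have x: "x \<in> topspace X" "a < f x" by auto
    show "\<exists>T. openin X T \<and> x \<in> T \<and> T \<subseteq> {x \<in> topspace X. f x > a}"
    proof (cases "a < 0")
      case True
      then have "{x \<in> topspace X. f x > a} = topspace X"
        using f0 by (auto intro: order_less_le_trans)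
      then show ?thesis using x by auto
    next
      case False
      then have "0 \<le> a" by simp
      then obtain s where s: "s \<in> dyadics \<inter> {0..1}" "a < s" "s < f x"
        using dyadic_between[OF _ x(2) f1] by blast
      then obtain r where r: "r \<in> dyadics \<inter> {0..1}" "a < r" "r < s"
        using dyadic_between[OF \<open>0 \<le> a\<close> s(2)] by (metis IntE atLeastAtMost_iff)
      have "x \<notin> G s" using f_le[of s x] s by auto
      then have "x \<notin> X closure_of (G r)"
        using G[of r s] s r by blast
      moreover have "topspace X - X closure_of (G r) \<subseteq> {x \<in> topspace X. f x > a}"
      proof
        fix y assume "y \<in> topspace X - X closure_of (G r)"
        then have "y \<in> topspace X" "y \<notin> G r"
          by (auto simp: in_closure_of)
        then show "y \<in> {x \<in> topspace X. f x > a}"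
          using le_f[of r y] r by auto
      qed
      ultimately show ?thesis
        using x by (intro exI[of _ "topspace X - X closure_of (G r)"]) auto
    qed
  qed
  ultimately have "continuous_map X euclideanreal f"
    unfolding continuous_map_upper_lower_semicontinuous_lt by blast
  moreover have "f x = 0" if "x \<in> G 0" for x
    using f0[of x] f_le[of 0 x] that by (force simp: dyadics_def)
  moreover have "f x = 1" if "x \<notin> G 1" for x
    using f1[of x] le_f[of 1 x] that by (force simp: dyadics_def)
  ultimately show thesis
    using that f0 f1 by blast
qed

text \<open>
  The relation \<open>\<exists>n. star A (V n) \<subseteq> B\<close> is transitive and interpolative, and it puts the closure of \<open>A\<close>
  inside \<open>B\<close> and \<open>A\<close> inside the interior of \<open>B\<close>; recursion on dyadic fractions therefore gives a
  chain of sets between \<open>A\<close> and \<open>B\<close>.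
\<close>

lemma normal_sequence_separation:
  assumes V: "normal_sequence X V" and A: "A \<subseteq> topspace X" "star A (V n) \<subseteq> B"
  obtains g :: "'a \<Rightarrow> real" where "continuous_map X euclideanreal g" "\<And>x. 0 \<le> g x"
    "\<And>x. x \<in> A \<Longrightarrow> g x = 1" "\<And>x. x \<notin> B \<Longrightarrow> g x = 0"
proof -
  define R where "R A B \<longleftrightarrow> A \<subseteq> topspace X \<and> (\<exists>n. star A (V n) \<subseteq> B)" for A B
  have cov: "\<Union>(V n) = topspace X" for n
    using V by (simp add: normal_sequence_def nbhd_cover_def cover_of_def)
  have star_top: "star A (V n) \<subseteq> topspace X" for A n
    using cov[of n] by (auto simp: star_def)
  have sub_star: "A \<subseteq> star A (V n)" if "A \<subseteq> topspace X" for A n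
  proof
    fix x assume "x \<in> A"
    then have "x \<in> \<Union>(V n)" using that cov by blast
    with \<open>x \<in> A\<close> show "x \<in> star A (V n)" unfolding star_def by blast
  qed
  have nbhd: "\<exists>U. openin X U \<and> x \<in> U \<and> U \<subseteq> star {x} (V n)" if "x \<in> topspace X" for x n
    using V that by (simp add: normal_sequence_def nbhd_cover_def)
  have "\<exists>G :: real \<Rightarrow> 'a set. G 0 = A \<and> G 1 = B \<and>
          (\<forall>r \<in> dyadics \<inter> {0..1}. \<forall>s \<in> dyadics \<inter> {0..1}. r < s \<longrightarrow> R (G r) (G s))"
  proof (rule recursion_on_dyadic_fractions)
    show "R A B" using A by (auto simp: R_def)
    show "\<exists>Z. R A Z \<and> R Z B" if AB: "R A B" for A B
    proof -
      obtain n where n: "A \<subseteq> topspace X" "star A (V n) \<subseteq> B"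
        using AB by (auto simp: R_def)
      have "star_refines (V (Suc n)) (V n)"
        using V by (simp add: normal_sequence_def)
      then have "star (star A (V (Suc n))) (V (Suc n)) \<subseteq> B"
        using star_star_subset n(2) by blast
      then show ?thesis
        using n(1) star_top unfolding R_def by blast
    qed
    show "R A C" if "R A B" "R B C" for A B C
      using that sub_star unfolding R_def by (meson subset_trans)
  qed
  then obtain G :: "real \<Rightarrow> 'a set" where G: "G 0 = A" "G 1 = B"
     "\<And>r s. r \<in> dyadics \<inter> {0..1} \<Longrightarrow> s \<in> dyadics \<inter> {0..1} \<Longrightarrow> r < s \<Longrightarrow> R (G r) (G s)"
    by blast
  have R_int: "A \<subseteq> X interior_of B \<and> X closure_of A \<subseteq> B" if AB: "R A B" for A B
  proof -
    obtain n where n: "A \<subseteq> topspace X" "star A (V n) \<subseteq> B"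
      using AB by (auto simp: R_def)
    have "x \<in> X interior_of B" if x: "x \<in> A" for x
    proof -
      have "x \<in> topspace X" using n(1) x by blast
      then obtain U where "openin X U" "x \<in> U" "U \<subseteq> star {x} (V n)"
        using nbhd by blast
      moreover have "star {x} (V n) \<subseteq> B"
        using star_mono[of "{x}" A] x n(2) by blast
      ultimately show ?thesis
        by (auto simp: interior_of_def)
    qed
    moreover have "y \<in> B" if "y \<in> X closure_of A" for y
    proof -
      have "y \<in> topspace X" using that by (simp add: in_closure_of)
      then obtain U where U: "openin X U" "y \<in> U" "U \<subseteq> star {y} (V n)"
        using nbhd by blast
      then obtain a where "a \<in> A" "a \<in> star {y} (V n)"
        using \<open>y \<in> X closure_of A\<close> unfolding in_closure_of by blast
      then have "y \<in> star A (V n)"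
        unfolding star_def by blast
      then show ?thesis using n(2) by blast
    qed
    ultimately show ?thesis by blast
  qed
  obtain f :: "'a \<Rightarrow> real" where "continuous_map X euclideanreal f" "\<And>x. 0 \<le> f x" "\<And>x. f x \<le> 1"
    "\<And>x. x \<in> G 0 \<Longrightarrow> f x = 0" "\<And>x. x \<notin> G 1 \<Longrightarrow> f x = 1"
    using continuous_map_dyadic_chain[of G X] R_int G(3) by blast
  then show thesis
    using G(1,2) by (intro that[of "\<lambda>x. 1 - f x"]) (auto intro!: continuous_map_diff)
qed

text \<open>
  A substitute for a partition of unity: the functions need not sum to \<open>1\<close>, but at each point one of
  them is \<open>1\<close>.
\<close>

lemma normal_cover_functions:
  assumes "C \<in> normal_covers X"
  obtains g :: "'a set \<Rightarrow> 'a \<Rightarrow> real" where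
    "\<And>A. A \<in> C \<Longrightarrow> continuous_map X euclideanreal (g A)"
    "\<And>A x. A \<in> C \<Longrightarrow> 0 \<le> g A x"
    "\<And>A x. A \<in> C \<Longrightarrow> x \<notin> A \<Longrightarrow> g A x = 0"
    "\<And>x. x \<in> topspace X \<Longrightarrow> \<exists>A\<in>C. g A x = 1"
proof -
  obtain V where V: "normal_sequence X V" and ref: "cover_refines (V 0) C"
    using assms by (auto simp: normal_covers_def)
  \<comment> \<open>These shrunken members still cover the space, and \<open>V 1\<close> separates them from the complements.\<close>
  define K where "K A = {x \<in> topspace X. star {x} (V 1) \<subseteq> A}" for A
  have "star (K A) (V 1) \<subseteq> A" for A
    unfolding K_def star_def by blast
  then have "\<exists>g :: 'a \<Rightarrow> real. continuous_map X euclideanreal g \<and> (\<forall>x. 0 \<le> g x) \<and>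
      (\<forall>x\<in>K A. g x = 1) \<and> (\<forall>x. x \<notin> A \<longrightarrow> g x = 0)" for A
    using normal_sequence_separation[OF V, of "K A" 1 A] by (metis (no_types, lifting) K_def mem_Collect_eq subsetI)
  then obtain g :: "'a set \<Rightarrow> 'a \<Rightarrow> real" where g: "\<And>A. continuous_map X euclideanreal (g A)"
     "\<And>A x. 0 \<le> g A x" "\<And>A x. x \<in> K A \<Longrightarrow> g A x = 1" "\<And>A x. x \<notin> A \<Longrightarrow> g A x = 0"
    by metis
  have "\<exists>A\<in>C. g A x = 1" if "x \<in> topspace X" for x
  proof -
    have "x \<in> \<Union>(V 1)"
      using V that by (simp add: normal_sequence_def nbhd_cover_def cover_of_def)
    then obtain B where B: "B \<in> V 1" "x \<in> B" by blast
    have "star_refines (V 1) (V 0)"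
      using V by (simp add: normal_sequence_def)
    then obtain B' where "B' \<in> V 0" "star B (V 1) \<subseteq> B'"
      using B(1) unfolding star_refines_def by blast
    moreover obtain A where "A \<in> C" "B' \<subseteq> A"
      using ref \<open>B' \<in> V 0\<close> unfolding cover_refines_def by blast
    ultimately have A: "A \<in> C" "star B (V 1) \<subseteq> A"
      by auto
    then have "x \<in> K A"
      using star_mono[of "{x}" B] B that by (auto simp: K_def)
    then show ?thesis using A(1) g(3) by blast
  qed
  with g show thesis by (intro that[of g])
qed

lemma continuous_map_locally:
  assumes "\<And>x. x \<in> topspace X \<Longrightarrow>
     \<exists>U h. openin X U \<and> x \<in> U \<and> continuous_map X Y h \<and> (\<forall>y\<in>U. f y = h y)"
  shows "continuous_map X Y f"
  unfolding continuous_map_def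
proof (intro conjI allI impI)
  show "f \<in> topspace X \<rightarrow> topspace Y"
  proof
    fix x assume "x \<in> topspace X"
    then obtain U h where "x \<in> U" "continuous_map X Y h" "\<forall>y\<in>U. f y = h y"
      using assms by blast
    then show "f x \<in> topspace Y"
      using \<open>x \<in> topspace X\<close> by (metis continuous_map_funspace funcset_mem)
  qed
  fix W assume W: "openin Y W"
  show "openin X {x \<in> topspace X. f x \<in> W}"
  proof (subst openin_subopen, intro ballI)
    fix x assume x: "x \<in> {x \<in> topspace X. f x \<in> W}"
    then obtain U h where U: "openin X U" "x \<in> U" "continuous_map X Y h" "\<forall>y\<in>U. f y = h y"
      using assms by blast
    then have "openin X (U \<inter> {x \<in> topspace X. h x \<in> W})"
      using W by (intro openin_Int openin_continuous_map_preimage)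
    then show "\<exists>T. openin X T \<and> x \<in> T \<and> T \<subseteq> {x \<in> topspace X. f x \<in> W}"
      using x U by (intro exI[of _ "U \<inter> {x \<in> topspace X. h x \<in> W}"]) auto
  qed
qed

section \<open>Functionally convergent filters and open partitions\<close>

text \<open>
  Proper filters on the space along which every continuous real function has a limit.
\<close>

definition functionally_convergent :: "'a topology \<Rightarrow> 'a filter \<Rightarrow> bool" where
  "functionally_convergent X F \<longleftrightarrow> F \<noteq> bot \<and> F \<le> principal (topspace X) \<and>
     (\<forall>f. continuous_map X euclideanreal f \<longrightarrow> (\<exists>l. (f \<longlongrightarrow> l) F))"

lemma functionally_convergent_topspace:
  "functionally_convergent X F \<Longrightarrow> \<forall>\<^sub>F x in F. x \<in> topspace X"
  by (simp add: functionally_convergent_def le_principal)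

lemma continuous_map_open_partition:
  assumes P: "open_partition X P" and Y: "f ` topspace X \<subseteq> topspace Y"
    and f: "\<And>Q x y. Q \<in> P \<Longrightarrow> x \<in> Q \<Longrightarrow> y \<in> Q \<Longrightarrow> f x = f y"
  shows "continuous_map X Y f"
proof (rule continuous_map_locally)
  fix x assume x: "x \<in> topspace X"
  then have "x \<in> \<Union>P"
    using P by (simp add: open_partition_def partition_on_def)
  then obtain Q where Q: "Q \<in> P" "x \<in> Q" by blast
  have "openin X Q"
    using P Q(1) by (simp add: open_partition_def)
  moreover have "continuous_map X Y (\<lambda>_. f x)"
    using Y x by auto
  moreover have "\<forall>y\<in>Q. f y = f x"
    using f Q by blast
  ultimately show "\<exists>U h. openin X U \<and> x \<in> U \<and> continuous_map X Y h \<and> (\<forall>y\<in>U. f y = h y)"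
    using Q(2) by blast
qed

text \<open>
  Limits of characteristic functions of unions of pieces decide each family of pieces; a countable
  subfamily with empty intersection would give an integer-valued function, constant on pieces, that
  tends to infinity along the filter.
\<close>

lemma functionally_convergent_partition_ultrafilter:
  assumes F: "functionally_convergent X F" and P: "open_partition X P"
  defines "U \<equiv> {R. R \<subseteq> P \<and> (\<forall>\<^sub>F x in F. x \<in> \<Union>R)}"
  shows "ultrafilter_on P U" "countable_intersection_property U"
proof -
  have UP: "\<Union>P = topspace X" and disj: "\<And>A B. A \<in> P \<Longrightarrow> B \<in> P \<Longrightarrow> A \<noteq> B \<Longrightarrow> A \<inter> B = {}"
    using P by (auto simp: open_partition_def partition_on_def disjoint_def)
  have same: "A = B" if "A \<in> P" "B \<in> P" "x \<in> A" "x \<in> B" for A B x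
    using disj that by blast
  have nb: "F \<noteq> bot" and conv: "\<And>f. continuous_map X euclideanreal f \<Longrightarrow> \<exists>l. (f \<longlongrightarrow> l) F"
    using F by (auto simp: functionally_convergent_def)
  note ev = functionally_convergent_topspace[OF F]
  show "ultrafilter_on P U"
    unfolding ultrafilter_on_def
  proof (intro conjI ballI allI impI)
    show "U \<subseteq> Pow P" by (auto simp: U_def)
    show "P \<in> U" using ev by (simp add: U_def flip: UP)
    show "{} \<notin> U" using nb by (simp add: U_def trivial_limit_def)
    show "A \<inter> B \<in> U" if "A \<in> U" "B \<in> U" for A B
    proof -
      have ev2: "\<forall>\<^sub>F x in F. x \<in> \<Union>A \<and> x \<in> \<Union>B" and "A \<subseteq> P" "B \<subseteq> P"
        using that by (auto simp: U_def intro: eventually_conj)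
      have "x \<in> \<Union>(A \<inter> B)" if x: "x \<in> \<Union>A \<and> x \<in> \<Union>B" for x
      proof -
        obtain Q Q' where "Q \<in> A" "x \<in> Q" "Q' \<in> B" "x \<in> Q'"
          using x by blast
        moreover from this have "Q = Q'"
          using same \<open>A \<subseteq> P\<close> \<open>B \<subseteq> P\<close> by blast
        ultimately show ?thesis by blast
      qed
      then have "\<forall>\<^sub>F x in F. x \<in> \<Union>(A \<inter> B)"
        by (rule eventually_mono[OF ev2])
      then show ?thesis
        using \<open>A \<subseteq> P\<close> unfolding U_def by blast
    qed
    show "B \<in> U" if "A \<in> U" "A \<subseteq> B \<and> B \<subseteq> P" for A B
    proof -
      have "\<forall>\<^sub>F x in F. x \<in> \<Union>A" using that by (simp add: U_def)
      then have "\<forall>\<^sub>F x in F. x \<in> \<Union>B"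
        by (rule eventually_mono) (use that in blast)
      then show ?thesis using that by (simp add: U_def)
    qed
    show "A \<in> U \<or> P - A \<in> U" if "A \<subseteq> P" for A
    proof -
      have "continuous_map X euclideanreal (indicat_real (\<Union>A))"
      proof (rule continuous_map_open_partition[OF P])
        show "indicat_real (\<Union>A) x = indicat_real (\<Union>A) y" if Q: "Q \<in> P" "x \<in> Q" "y \<in> Q" for Q x y
        proof -
          have "z \<in> \<Union>A \<longleftrightarrow> Q \<in> A" if "z \<in> Q" for z
            using same[OF Q(1)] that \<open>A \<subseteq> P\<close> by blast
          then show ?thesis using Q by (simp add: indicator_def)
        qed
      qed simp
      then obtain l where "(indicat_real (\<Union>A) \<longlongrightarrow> l) F" using conv by blast
      then have near: "\<forall>\<^sub>F x in F. \<bar>indicat_real (\<Union>A) x - l\<bar> < 1/2"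
        using tendstoD[of _ l F "1/2"] by (simp add: dist_real_def)
      show ?thesis
      proof (cases "l > 1/2")
        case True
        have "\<forall>\<^sub>F x in F. x \<in> \<Union>A"
          using near
        proof eventually_elim
          case (elim x)
          then have "indicat_real (\<Union>A) x \<noteq> 0" using True by auto
          then show ?case by (meson indicator_simps(2))
        qed
        then show ?thesis using that by (simp add: U_def)
      next
        case False
        have "\<forall>\<^sub>F x in F. x \<in> \<Union>(P - A)"
          using near ev
        proof eventually_elim
          case (elim x)
          then have "indicat_real (\<Union>A) x \<noteq> 1" "x \<in> \<Union>P"
            using False UP by auto
          then have "x \<notin> \<Union>A" "x \<in> \<Union>P"
            by (meson indicator_simps(1))+
          then show ?case by blast
        qed
        then show ?thesis by (simp add: U_def)
      qed
    qed
  qed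
  show "countable_intersection_property U"
    unfolding countable_intersection_property_def
  proof (intro allI impI notI)
    fix W assume W: "W \<subseteq> U \<and> countable W" and empty: "\<Inter>W = {}"
    then have "W \<noteq> {}" by auto
    then obtain q :: "nat \<Rightarrow> 'a set set" where q: "range q = W"
      using W by (metis range_from_nat_into)
    \<comment> \<open>The function that tends to infinity: the first index at which \<open>x\<close> is left out.\<close>
    define h where "h x = (LEAST n. x \<notin> \<Union>(q n))" for x
    have qP: "q n \<subseteq> P" "\<forall>\<^sub>F x in F. x \<in> \<Union>(q n)" for n
    proof -
      have "q n \<in> U" using q W by blast
      then show "q n \<subseteq> P" "\<forall>\<^sub>F x in F. x \<in> \<Union>(q n)" by (auto simp: U_def)
    qed
    have mem: "x \<in> \<Union>(q n) \<longleftrightarrow> Q \<in> q n" if "Q \<in> P" "x \<in> Q" for Q x n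
      using same[OF that(1) _ that(2)] qP(1)[of n] that by blast
    have "continuous_map X euclideanreal (\<lambda>x. real (h x))"
    proof (rule continuous_map_open_partition[OF P])
      show "real (h x) = real (h y)" if "Q \<in> P" "x \<in> Q" "y \<in> Q" for Q x y
        using mem that by (simp add: h_def)
    qed simp
    then obtain l where "((\<lambda>x. real (h x)) \<longlongrightarrow> l) F" using conv by blast
    then have ev_h: "\<forall>\<^sub>F x in F. real (h x) < l + 1"
      by (rule order_tendstoD) simp
    obtain N :: nat where N: "l + 1 \<le> real N"
      using real_arch_simple by blast
    have "\<forall>\<^sub>F x in F. \<forall>n\<in>{..N}. x \<in> \<Union>(q n)"
      using qP(2) by (intro eventually_ball_finite) auto
    with ev_h ev have "\<forall>\<^sub>F x in F. h x < N \<and> (\<forall>n\<in>{..N}. x \<in> \<Union>(q n)) \<and> x \<in> topspace X"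
      by eventually_elim (use N in auto)
    from eventually_happens'[OF nb this]
    obtain x where x: "h x < N" "\<And>n. n \<le> N \<Longrightarrow> x \<in> \<Union>(q n)" "x \<in> topspace X"
      by blast
    obtain Q where Q: "Q \<in> P" "x \<in> Q" using x(3) UP by blast
    have "Q \<notin> \<Inter>(range q)" using empty q by simp
    then obtain n where "Q \<notin> q n" by blast
    then have "x \<notin> \<Union>(q n)" using mem Q by blast
    then have "x \<notin> \<Union>(q (h x))"
      unfolding h_def by (rule LeastI)
    with x show False by simp
  qed
qed

lemma functionally_convergent_partition_member:
  assumes F: "functionally_convergent X F" and P: "open_partition X P"
    and not: "\<not> Ulam_measurable |P|"
  obtains Q where "Q \<in> P" "\<forall>\<^sub>F x in F. x \<in> Q"
proof -
  define U where "U = {R. R \<subseteq> P \<and> (\<forall>\<^sub>F x in F. x \<in> \<Union>R)}"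
  have U: "ultrafilter_on P U" "countable_intersection_property U"
    using functionally_convergent_partition_ultrafilter[OF F P] by (auto simp: U_def)
  have "\<Inter>U \<noteq> {}"
  proof
    assume free: "\<Inter>U = {}"
    \<comment> \<open>On a finite partition \<open>U\<close> is finite, and the countable intersection property covers \<open>U\<close> itself.\<close>
    have "infinite P"
    proof
      assume "finite P"
      moreover have "U \<subseteq> Pow P" by (auto simp: U_def)
      ultimately have "countable U"
        by (meson countable_finite finite_Pow_iff finite_subset)
      then show False
        using U(2) free by (auto simp: countable_intersection_property_def)
    qed
    then have "Cinfinite |P|"
      by (simp add: cinfinite_def Field_card_of card_of_card_order_on)
    then have "Ulam_measurable |P|"
      unfolding Ulam_measurable_def using U free card_of_refl by blast
    with not show False by simp
  qed
  then obtain Q where Q: "\<And>R. R \<in> U \<Longrightarrow> Q \<in> R" by blast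
  have "P \<in> U" using U(1) by (simp add: ultrafilter_on_def)
  then have "Q \<in> P" using Q by blast
  then have "{Q} \<in> U \<or> P - {Q} \<in> U"
    using U(1) by (simp add: ultrafilter_on_def)
  then have "{Q} \<in> U" using Q by blast
  then show thesis
    using \<open>Q \<in> P\<close> by (intro that) (auto simp: U_def)
qed

section \<open>Star-finite covers\<close>

text \<open>
  The pieces are the unions of the classes of the equivalence generated by intersection of members.
  A class is countable because it is reached from one member by finite branching. The last clause
  says that a piece meets no member outside its class.
\<close>

lemma star_finite_cover_components:
  assumes C: "cover_of S C" "star_finite C"
  obtains P where "partition_on S P"
    "\<And>Q. Q \<in> P \<Longrightarrow> \<exists>D\<subseteq>C. countable D \<and> Q = \<Union>D \<and> (\<forall>A\<in>C. A \<inter> Q \<noteq> {} \<longrightarrow> A \<in> D)"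
proof -
  define r where "r = {(A, B). A \<in> C \<and> B \<in> C \<and> A \<inter> B \<noteq> {}}"
  define K where "K A = r\<^sup>* `` {A}" for A
  have "sym r" by (auto simp: sym_def r_def)
  then have symr: "sym (r\<^sup>*)" by (rule sym_rtrancl)
  have KC: "K A \<subseteq> C" if "A \<in> C" for A
  proof
    fix B assume "B \<in> K A"
    then have "(A, B) \<in> r\<^sup>*" by (simp add: K_def)
    then show "B \<in> C" using that by (induction) (auto simp: r_def)
  qed
  have KI: "B \<in> K A" if AB: "A \<in> C" "B \<in> C" "B \<inter> \<Union>(K A) \<noteq> {}" for A B
  proof -
    obtain D where D: "D \<in> K A" "B \<inter> D \<noteq> {}" using AB(3) by blast
    then have "(A, D) \<in> r\<^sup>*" "(D, B) \<in> r"
      using KC[OF AB(1)] AB(2) by (auto simp: K_def r_def)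
    then show ?thesis by (auto simp: K_def intro: rtrancl_into_rtrancl)
  qed
  have countable: "countable (K A)" if "A \<in> C" for A
    unfolding K_def
  proof (rule countable_rtrancl)
    fix Y :: "'a set set" assume "countable Y"
    have "finite (r `` {B})" for B
    proof (cases "B \<in> C")
      case True
      then have "r `` {B} \<subseteq> {A \<in> C. A \<inter> B \<noteq> {}}" by (auto simp: r_def)
      then show ?thesis
        using C(2) True unfolding star_finite_def by (meson finite_subset)
    qed (simp add: r_def)
    then have "countable (\<Union>B\<in>Y. r `` {B})"
      using \<open>countable Y\<close> by (intro countable_UN) (auto intro: countable_finite)
    then show "countable (r `` Y)"
      by (simp add: Image_eq_UN[of r Y])
  qed simp
  define P where "P = {\<Union>(K A) |A. A \<in> C \<and> A \<noteq> {}}"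
  have selfK: "A \<in> K A" for A by (simp add: K_def)
  have "partition_on S P"
    unfolding partition_on_def disjoint_def
  proof (intro conjI ballI impI)
    have sub: "\<Union>(K A) \<subseteq> S" if "A \<in> C" for A
      using KC[OF that] C(1) unfolding cover_of_def by blast
    show "\<Union>P = S"
    proof
      show "\<Union>P \<subseteq> S" using sub unfolding P_def by blast
      show "S \<subseteq> \<Union>P"
      proof
        fix x assume "x \<in> S"
        then have "x \<in> \<Union>C" using C(1) by (simp add: cover_of_def)
        then obtain A where A: "A \<in> C" "x \<in> A" by blast
        then have "x \<in> \<Union>(K A)" "\<Union>(K A) \<in> P"
          using selfK unfolding P_def by blast+
        then show "x \<in> \<Union>P" by (rule UnionI[rotated])
      qed
    qed
    show "{} \<notin> P"
    proof
      assume "{} \<in> P"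
      then obtain A where "A \<noteq> {}" "\<Union>(K A) = {}" by (auto simp: P_def)
      then show False using selfK by blast
    qed
    fix Q Q' assume "Q \<in> P" "Q' \<in> P" "Q \<noteq> Q'"
    then obtain A B where AB: "A \<in> C" "Q = \<Union>(K A)" "B \<in> C" "Q' = \<Union>(K B)"
      unfolding P_def by blast
    show "Q \<inter> Q' = {}"
    proof (rule ccontr)
      assume "Q \<inter> Q' \<noteq> {}"
      then obtain D where D: "D \<in> K A" "D \<inter> \<Union>(K B) \<noteq> {}"
        using AB by blast
      then have "D \<in> K B" using KI[OF AB(3)] KC[OF AB(1)] by blast
      then have "(A, D) \<in> r\<^sup>*" "(B, D) \<in> r\<^sup>*" using D by (auto simp: K_def)
      then have "(A, B) \<in> r\<^sup>*" "(B, A) \<in> r\<^sup>*"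
        using symr by (meson symD rtrancl_trans)+
      then have "K A = K B"
        unfolding K_def by (blast intro: rtrancl_trans)
      then show False using AB \<open>Q \<noteq> Q'\<close> by simp
    qed
  qed
  moreover have "\<exists>D\<subseteq>C. countable D \<and> Q = \<Union>D \<and> (\<forall>A\<in>C. A \<inter> Q \<noteq> {} \<longrightarrow> A \<in> D)" if Q: "Q \<in> P" for Q
  proof -
    obtain A where A: "A \<in> C" "Q = \<Union>(K A)" using Q unfolding P_def by blast
    then show ?thesis
      using KC countable KI by (intro exI[of _ "K A"]) auto
  qed
  ultimately show thesis by (rule that)
qed

text \<open>
  The step that turns convergence of real functions into the Cauchy property: a functionally
  convergent filter contains a member of every star-finite open normal cover.
\<close>

lemma functionally_convergent_star_finite_cover:
  assumes F: "functionally_convergent X F" and C: "C \<in> normal_covers X" "star_finite C"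
    and opn: "\<And>A. A \<in> C \<Longrightarrow> openin X A"
    and not: "\<And>P. open_partition X P \<Longrightarrow> \<not> Ulam_measurable |P|"
  shows "\<exists>A\<in>C. \<forall>\<^sub>F x in F. x \<in> A"
proof -
  have nb: "F \<noteq> bot" and conv: "\<And>f. continuous_map X euclideanreal f \<Longrightarrow> \<exists>l. (f \<longlongrightarrow> l) F"
    using F by (auto simp: functionally_convergent_def)
  note ev = functionally_convergent_topspace[OF F]
  have cov: "cover_of (topspace X) C" using C(1) by (simp add: normal_covers_def)
  obtain P where P: "partition_on (topspace X) P"
    "\<And>Q. Q \<in> P \<Longrightarrow> \<exists>D\<subseteq>C. countable D \<and> Q = \<Union>D \<and> (\<forall>A\<in>C. A \<inter> Q \<noteq> {} \<longrightarrow> A \<in> D)"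
    using star_finite_cover_components[OF cov C(2)] by blast
  have "openin X Q" if "Q \<in> P" for Q
    using P(2)[OF that] opn by (metis openin_Union subset_eq)
  then have "open_partition X P"
    using P(1) by (simp add: open_partition_def)
  then obtain Q where "Q \<in> P" and evQ: "\<forall>\<^sub>F x in F. x \<in> Q"
    using functionally_convergent_partition_member[OF F] not by blast
  then obtain D where D: "D \<subseteq> C" "countable D" "Q = \<Union>D" "\<And>A. A \<in> C \<Longrightarrow> A \<inter> Q \<noteq> {} \<Longrightarrow> A \<in> D"
    using P(2) by meson
  obtain g :: "'a set \<Rightarrow> 'a \<Rightarrow> real" where g:
    "\<And>A. A \<in> C \<Longrightarrow> continuous_map X euclideanreal (g A)"
    "\<And>A x. A \<in> C \<Longrightarrow> 0 \<le> g A x"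
    "\<And>A x. A \<in> C \<Longrightarrow> x \<notin> A \<Longrightarrow> g A x = 0"
    "\<And>x. x \<in> topspace X \<Longrightarrow> \<exists>A\<in>C. g A x = 1"
    using normal_cover_functions[OF C(1)] by blast
  show ?thesis
  proof (cases "\<exists>A\<in>D. \<exists>l>0. (g A \<longlongrightarrow> l) F")
    case True
    then obtain A l where A: "A \<in> D" "l > 0" "(g A \<longlongrightarrow> l) F" by blast
    then have "\<forall>\<^sub>F x in F. g A x > 0"
      by (intro order_tendstoD(1))
    then have "\<forall>\<^sub>F x in F. x \<in> A"
      by (rule eventually_mono) (use g(3) A(1) D(1) in force)
    then show ?thesis using A(1) D(1) by blast
  next
    case False
    have small: "\<forall>\<^sub>F x in F. g A x < 1" if A: "A \<in> D" for A
    proof -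
      have "continuous_map X euclideanreal (g A)" using g(1) D(1) A by blast
      then obtain l where l: "(g A \<longlongrightarrow> l) F" using conv by blast
      then have "\<not> l > 0" using False A by blast
      then have "l < 1" by simp
      with l show ?thesis by (rule order_tendstoD(2))
    qed
    \<comment> \<open>The sum is taken over the members through \<open>x\<close>, weighted by their indices in an enumeration of
      \<open>D\<close>. On a member \<open>B\<close> of \<open>C\<close> it is a fixed finite sum, hence continuous.\<close>
    define idx where "idx = to_nat_on D"
    have inj: "inj_on idx D" using inj_on_to_nat_on[OF D(2)] by (simp add: idx_def)
    have fin: "finite {A \<in> D. A \<inter> B \<noteq> {}}" if "B \<in> C" for B
    proof (rule finite_subset)
      show "finite {A \<in> C. A \<inter> B \<noteq> {}}" using C(2) that by (simp add: star_finite_def)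
    qed (use D(1) in blast)
    define f where "f x = (\<Sum>A | A \<in> D \<and> x \<in> A. real (idx A) * g A x)" for x
    have f_eq: "f x = (\<Sum>A | A \<in> D \<and> A \<inter> B \<noteq> {}. real (idx A) * g A x)" if "B \<in> C" "x \<in> B" for B x
      unfolding f_def
      by (rule sum.mono_neutral_left) (use fin[OF that(1)] that g(3) D(1) in auto)
    have "continuous_map X euclideanreal f"
    proof (rule continuous_map_locally)
      fix x assume "x \<in> topspace X"
      then have "x \<in> \<Union>C" using cov by (simp add: cover_of_def)
      then obtain B where B: "B \<in> C" "x \<in> B" by blast
      let ?h = "\<lambda>y. \<Sum>A | A \<in> D \<and> A \<inter> B \<noteq> {}. real (idx A) * g A y"
      have "continuous_map X euclideanreal ?h"
        using fin[OF B(1)] g(1) D(1)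
        by (intro continuous_map_sum continuous_map_real_mult) auto
      then show "\<exists>U h. openin X U \<and> x \<in> U \<and> continuous_map X euclideanreal h \<and> (\<forall>y\<in>U. f y = h y)"
        using B opn f_eq by blast
    qed
    then obtain l where "(f \<longlongrightarrow> l) F" using conv by blast
    then have ev_f: "\<forall>\<^sub>F x in F. f x < l + 1"
      by (rule order_tendstoD) simp
    obtain N :: nat where N: "l + 1 \<le> real N"
      using real_arch_simple by blast
    have "\<forall>\<^sub>F x in F. \<forall>A\<in>{A \<in> D. idx A < N}. g A x < 1"
    proof (rule eventually_ball_finite)
      have "finite (idx ` {A \<in> D. idx A < N})"
        by (rule finite_subset[of _ "{..<N}"]) auto
      moreover have "inj_on idx {A \<in> D. idx A < N}"
        using inj by (rule inj_on_subset) auto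
      ultimately show "finite {A \<in> D. idx A < N}"
        by (rule finite_imageD)
    qed (use small in auto)
    with ev_f ev evQ have "\<forall>\<^sub>F x in F. f x < real N \<and> (\<forall>A\<in>D. idx A < N \<longrightarrow> g A x < 1) \<and> x \<in> Q \<and> x \<in> topspace X"
      by eventually_elim (use N in auto)
    from eventually_happens'[OF nb this]
    obtain x where x: "f x < real N" "\<And>A. A \<in> D \<Longrightarrow> idx A < N \<Longrightarrow> g A x < 1" "x \<in> Q" "x \<in> topspace X"
      by blast
    obtain A where A: "A \<in> C" "g A x = 1" using g(4)[OF x(4)] by blast
    then have "x \<in> A" using g(3)[of A x] by fastforce
    then have "A \<in> D" using D(4) A(1) x(3) by blast
    have "finite {B. B \<in> D \<and> x \<in> B}"
      by (rule finite_subset[OF _ fin[OF A(1)]]) (use \<open>x \<in> A\<close> in auto)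
    then have "real (idx A) * g A x \<le> f x"
      unfolding f_def using \<open>A \<in> D\<close> \<open>x \<in> A\<close> g(2) D(1)
      by (intro member_le_sum) auto
    then have "idx A < N" using A(2) x(1) by simp
    then show ?thesis using x(2) \<open>A \<in> D\<close> A(2) by fastforce
  qed
qed

lemma functionally_convergent_imp_Cauchy:
  assumes X: "Tychonoff_space X" and F: "functionally_convergent X F"
    and not: "\<And>P. open_partition X P \<Longrightarrow> \<not> Ulam_measurable |P|"
  shows "Cauchy_filter_on (topspace X) (star_finite_uniformity X (fine_uniformity X)) F"
  unfolding Cauchy_filter_on_def
proof (intro conjI ballI)
  fix D assume "D \<in> star_finite_uniformity X (fine_uniformity X)"
  then obtain C where C: "C \<in> normal_covers X" "star_finite C" "\<And>A. A \<in> C \<Longrightarrow> openin X A" "cover_refines C D"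
    unfolding star_finite_uniformity_def fine_uniformity_eq_normal_covers[OF X] by blast
  then obtain A where A: "A \<in> C" "\<forall>\<^sub>F x in F. x \<in> A"
    using functionally_convergent_star_finite_cover[OF F _ _ _ not] by blast
  then obtain B where "B \<in> D" "A \<subseteq> B"
    using C(4) unfolding cover_refines_def by blast
  with A(2) show "\<exists>B\<in>D. \<forall>\<^sub>F x in F. x \<in> B"
    by (meson eventually_mono subsetD)
qed (use F in \<open>auto simp: functionally_convergent_def\<close>)

section \<open>Realcompactness\<close>

lemma realcompact_limit:
  assumes X: "realcompact_space X" and F: "functionally_convergent X F"
  obtains x where "limitin X (\<lambda>y. y) x F"
proof -
  obtain I :: "('a \<Rightarrow> real) set" and C where C: "closedin (product_topology (\<lambda>_. euclideanreal) I) C"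
    and "X homeomorphic_space subtopology (product_topology (\<lambda>_. euclideanreal) I) C"
    using X unfolding realcompact_space_def by blast
  moreover define P where "P = product_topology (\<lambda>_. euclideanreal) I"
  ultimately obtain h g where hg: "homeomorphic_maps X (subtopology P C) h g" and C: "closedin P C"
    unfolding homeomorphic_space_def by blast
  have h: "continuous_map X P h" and hC: "\<And>x. x \<in> topspace X \<Longrightarrow> h x \<in> C"
    and g: "continuous_map (subtopology P C) X g"
    and gh: "\<And>x. x \<in> topspace X \<Longrightarrow> g (h x) = x"
    using hg unfolding homeomorphic_maps_def by (auto simp: continuous_map_in_subtopology)
  note ev = functionally_convergent_topspace[OF F]
  have "\<exists>l. ((\<lambda>x. h x i) \<longlongrightarrow> l) F" if "i \<in> I" for i
  proof -
    have "continuous_map X euclideanreal (\<lambda>x. h x i)"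
      using h that by (auto simp: P_def continuous_map_componentwise)
    then show ?thesis using F by (auto simp: functionally_convergent_def)
  qed
  then obtain l where l: "\<And>i. i \<in> I \<Longrightarrow> ((\<lambda>x. h x i) \<longlongrightarrow> l i) F" by metis
  have evP: "\<forall>\<^sub>F x in F. h x \<in> topspace P"
    using ev by (rule eventually_mono) (use h in \<open>auto simp: continuous_map_def\<close>)
  have lim: "limitin P h (restrict l I) F"
    using l evP unfolding P_def limitin_componentwise by simp
  have evC: "\<forall>\<^sub>F x in F. h x \<in> C"
    using ev by (rule eventually_mono) (rule hC)
  then have "restrict l I \<in> C"
    using limitin_closedin[OF lim C] F by (simp add: functionally_convergent_def)
  then have "limitin (subtopology P C) h (restrict l I) F"
    using lim evC by (simp add: limitin_subtopology)
  then have "limitin X (g \<circ> h) (g (restrict l I)) F"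
    using g by (rule continuous_map_limit[rotated])
  then have "limitin X (\<lambda>y. y) (g (restrict l I)) F"
    by (rule limitin_transform_eventually[rotated]) (use ev gh in \<open>auto elim: eventually_mono\<close>)
  then show thesis by (rule that)
qed

text \<open>
  The evaluation map embeds \<open>X\<close> into the product of lines indexed by all continuous functions. A
  point \<open>p\<close> in the closure of the image induces, by the traces of its neighbourhoods, a filter along
  which each \<open>f\<close> tends to the coordinate \<open>p f\<close>.
\<close>

lemma realcompact_spaceI:
  fixes X :: "'a topology"
  assumes X: "Tychonoff_space X"
    and lim: "\<And>F. functionally_convergent X F \<Longrightarrow> \<exists>x. limitin X (\<lambda>y. y) x F"
  shows "realcompact_space X"
proof -
  have cr: "completely_regular_space X"
    using X by (simp add: Tychonoff_space_def)
  define I where "I = {f. continuous_map X euclideanreal f}"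
  define P where "P = product_topology (\<lambda>_. euclideanreal) I"
  define e where "e x = restrict (\<lambda>f. f x) I" for x :: 'a
  define C where "C = e ` topspace X"
  have e: "continuous_map X P e"
    unfolding P_def e_def by (auto simp: continuous_map_componentwise I_def)
  then have CP: "C \<subseteq> topspace P"
    by (auto simp: C_def continuous_map_def)
  have proj: "openin P {q \<in> topspace P. q f \<in> S}" if "f \<in> I" "open S" for f S
    using openin_continuous_map_preimage[OF continuous_map_product_projection[OF that(1)], of "\<lambda>_. euclideanreal" S] that(2)
    by (simp add: P_def)
  have "inj_on e (topspace X)"
  proof (rule inj_onI, rule ccontr)
    fix x y assume xy: "x \<in> topspace X" "y \<in> topspace X" "e x = e y" "x \<noteq> y"
    then obtain U V where "openin X U" "x \<in> U" "y \<in> V" "disjnt U V"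
      using X unfolding Tychonoff_space_def Hausdorff_space_def by blast
    then have "openin X U" "x \<in> U" "y \<notin> U" by (auto simp: disjnt_def)
    then obtain f where "continuous_map X euclideanreal f" "f x = 0" "f y = 1"
      using completely_regular_space_separation[OF cr] xy(2) by metis
    then have "e x f \<noteq> e y f" by (simp add: e_def I_def)
    with xy(3) show False by simp
  qed
  define g where "g = inv_into (topspace X) e"
  have ge: "g (e x) = x" if "x \<in> topspace X" for x
    using \<open>inj_on e (topspace X)\<close> that by (simp add: g_def)
  have g: "continuous_map (subtopology P C) X g"
    unfolding continuous_map_def
  proof (intro conjI allI impI)
    show "g \<in> topspace (subtopology P C) \<rightarrow> topspace X"
      using ge by (auto simp: C_def)
    fix G assume G: "openin X G"
    show "openin (subtopology P C) {q \<in> topspace (subtopology P C). g q \<in> G}"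
    proof (subst openin_subopen, intro ballI)
      fix q assume "q \<in> {q \<in> topspace (subtopology P C). g q \<in> G}"
      then obtain x where x: "q = e x" "x \<in> topspace X" "x \<in> G" "q \<in> C"
        using ge by (auto simp: C_def)
      obtain f where f: "continuous_map X euclideanreal f" "f x = 0" "\<And>y. y \<in> topspace X \<Longrightarrow> y \<notin> G \<Longrightarrow> f y = 1"
        using completely_regular_space_separation[OF cr G x(3)] by blast
      then have "f \<in> I" by (simp add: I_def)
      define T where "T = C \<inter> {q \<in> topspace P. q f \<in> {..<1}}"
      have "openin (subtopology P C) T"
        unfolding T_def by (intro openin_subtopology_Int2 proj) (auto simp: \<open>f \<in> I\<close>)
      moreover have "q \<in> T"
        using x f(2) \<open>f \<in> I\<close> CP by (auto simp: T_def e_def)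
      moreover have "T \<subseteq> {q \<in> topspace (subtopology P C). g q \<in> G}"
      proof
        fix q' assume q': "q' \<in> T"
        then obtain y where y: "q' = e y" "y \<in> topspace X"
          unfolding T_def C_def by blast
        have "f y < 1"
          using q' y(1) \<open>f \<in> I\<close> by (simp add: T_def e_def)
        then have "y \<in> G" using f(3)[OF y(2)] by fastforce
        then show "q' \<in> {q \<in> topspace (subtopology P C). g q \<in> G}"
          using q' ge y by (auto simp: T_def)
      qed
      ultimately show "\<exists>T. openin (subtopology P C) T \<and> q \<in> T \<and> T \<subseteq> {q \<in> topspace (subtopology P C). g q \<in> G}"
        by blast
    qed
  qed
  have "homeomorphic_maps X (subtopology P C) e g"
    unfolding homeomorphic_maps_def
    using e g ge by (auto simp: continuous_map_in_subtopology C_def)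
  then have hom: "X homeomorphic_space subtopology P C"
    unfolding homeomorphic_space_def by blast
  have "p \<in> C" if p: "p \<in> P closure_of C" for p
  proof -
    have pP: "p \<in> topspace P" and meet: "\<And>W. p \<in> W \<Longrightarrow> openin P W \<Longrightarrow> \<exists>x\<in>topspace X. e x \<in> W"
      using p by (auto simp: in_closure_of C_def)
    define F where "F = inf (filtercomap e (nhdsin P p)) (principal (topspace X))"
    have evF: "eventually Q F \<longleftrightarrow> (\<exists>W. openin P W \<and> p \<in> W \<and> (\<forall>x\<in>topspace X. e x \<in> W \<longrightarrow> Q x))" for Q
    proof
      assume "eventually Q F"
      then obtain R where R: "eventually R (nhdsin P p)" "\<And>x. R (e x) \<Longrightarrow> x \<in> topspace X \<Longrightarrow> Q x"
        unfolding F_def eventually_inf_principal eventually_filtercomap by blast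
      then show "\<exists>W. openin P W \<and> p \<in> W \<and> (\<forall>x\<in>topspace X. e x \<in> W \<longrightarrow> Q x)"
        using pP unfolding eventually_nhdsin by blast
    next
      assume "\<exists>W. openin P W \<and> p \<in> W \<and> (\<forall>x\<in>topspace X. e x \<in> W \<longrightarrow> Q x)"
      then obtain W where W: "openin P W" "p \<in> W" "\<And>x. x \<in> topspace X \<Longrightarrow> e x \<in> W \<Longrightarrow> Q x"
        by blast
      then have "eventually (\<lambda>q. q \<in> W) (nhdsin P p)"
        unfolding eventually_nhdsin by blast
      then show "eventually Q F"
        unfolding F_def eventually_inf_principal eventually_filtercomap
        using W(3) by blast
    qed
    have nb: "F \<noteq> bot"
      unfolding trivial_limit_def evF using meet by blast
    have tends: "(f \<longlongrightarrow> p f) F" if f: "f \<in> I" for f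
    proof (rule topological_tendstoI)
      fix S assume "open S" "p f \<in> S"
      then show "\<forall>\<^sub>F x in F. f x \<in> S"
        unfolding evF using proj[OF f] f pP
        by (intro exI[of _ "{q \<in> topspace P. q f \<in> S}"]) (auto simp: e_def)
    qed
    then have "functionally_convergent X F"
      using nb by (auto simp: functionally_convergent_def F_def I_def)
    then obtain x where x: "limitin X (\<lambda>y. y) x F" using lim by blast
    then have xX: "x \<in> topspace X" by (rule limitin_topspace)
    have "p f = f x" if f: "f \<in> I" for f
    proof -
      have "limitin euclideanreal (f \<circ> (\<lambda>y. y)) (f x) F"
        using f by (intro continuous_map_limit[OF _ x]) (simp add: I_def)
      then have "(f \<longlongrightarrow> f x) F" by (simp add: comp_def)
      then show ?thesis
        using tends[OF f] nb tendsto_unique by blast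
    qed
    then have "p = e x"
      using pP by (intro ext) (auto simp: e_def P_def PiE_def extensional_def)
    then show "p \<in> C" using xX by (simp add: C_def)
  qed
  then have "closedin P C"
    using CP closure_of_subset_eq by blast
  then show ?thesis
    using hom unfolding realcompact_space_def P_def by blast
qed

lemma Cauchy_imp_functionally_convergent:
  assumes X: "Tychonoff_space X"
    and F: "Cauchy_filter_on (topspace X) (star_finite_uniformity X (fine_uniformity X)) F"
  shows "functionally_convergent X F"
  unfolding functionally_convergent_def
proof (intro conjI allI impI)
  show nb: "F \<noteq> bot" and "F \<le> principal (topspace X)"
    using F by (auto simp: Cauchy_filter_on_def)
  fix f :: "'a \<Rightarrow> real" assume f: "continuous_map X euclideanreal f"
  have "cauchy_filter (filtermap f F)"
    unfolding cauchy_filter_metric_filtermap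
  proof (intro allI impI)
    fix \<epsilon> :: real assume "\<epsilon> > 0"
    then have "interval_cover X f (\<epsilon>/2) \<in> star_finite_uniformity X (fine_uniformity X)"
      by (intro interval_cover_star_finite_uniformity X f) simp
    then obtain A where A: "A \<in> interval_cover X f (\<epsilon>/2)" "\<forall>\<^sub>F x in F. x \<in> A"
      using F unfolding Cauchy_filter_on_def by blast
    from A(1) obtain k :: int where k: "\<And>x. x \<in> A \<Longrightarrow> \<bar>f x - of_int k * (\<epsilon>/2)\<bar> < \<epsilon>/2"
      by (auto simp: interval_cover_def)
    have "dist (f x) (f y) < \<epsilon>" if "x \<in> A" "y \<in> A" for x y
      using k[OF that(1)] k[OF that(2)] unfolding dist_real_def by linarith
    with A(2) show "\<exists>P. eventually P F \<and> (\<forall>x y. P x \<and> P y \<longrightarrow> dist (f x) (f y) < \<epsilon>)"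
      by blast
  qed
  moreover have "filtermap f F \<noteq> bot"
    using nb by (simp add: filtermap_bot_iff)
  ultimately obtain l where "filtermap f F \<le> nhds l"
    using complete_uniform[where S="UNIV :: real set"] complete_UNIV by force
  then show "\<exists>l. (f \<longlongrightarrow> l) F"
    by (auto simp: filterlim_def)
qed

section \<open>Countably complete ultrafilters\<close>

text \<open>
  An ultrafilter given as a family of subsets of \<open>S\<close>, as a filter in the sense of the type of
  filters.
\<close>

definition filter_of_ultrafilter :: "'a set \<Rightarrow> 'a set set \<Rightarrow> 'a filter" where
  "filter_of_ultrafilter S U = Abs_filter (\<lambda>Q. {s \<in> S. Q s} \<in> U)"

lemma eventually_filter_of_ultrafilter:
  assumes "ultrafilter_on S U"
  shows "eventually Q (filter_of_ultrafilter S U) \<longleftrightarrow> {s \<in> S. Q s} \<in> U"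
  unfolding filter_of_ultrafilter_def
proof (rule eventually_Abs_filter, unfold_locales)
  show "{s \<in> S. True} \<in> U" using assms by (simp add: ultrafilter_on_def)
  show "{s \<in> S. P s \<and> Q s} \<in> U" if "{s \<in> S. P s} \<in> U" "{s \<in> S. Q s} \<in> U" for P Q
  proof -
    have "{s \<in> S. P s} \<inter> {s \<in> S. Q s} \<in> U"
      using assms that unfolding ultrafilter_on_def by blast
    moreover have "{s \<in> S. P s} \<inter> {s \<in> S. Q s} = {s \<in> S. P s \<and> Q s}" by blast
    ultimately show ?thesis by simp
  qed
  show "{s \<in> S. Q s} \<in> U" if "\<forall>s. P s \<longrightarrow> Q s" "{s \<in> S. P s} \<in> U" for P Q
  proof -
    have "{s \<in> S. P s} \<subseteq> {s \<in> S. Q s}" "{s \<in> S. Q s} \<subseteq> S" using that by auto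
    then show ?thesis
      using assms that(2) unfolding ultrafilter_on_def by blast
  qed
qed

lemma countably_complete_ultrafilter_real_limit:
  fixes \<phi> :: "'a \<Rightarrow> real"
  assumes U: "ultrafilter_on S U" and cip: "countable_intersection_property U"
  obtains l where "(\<phi> \<longlongrightarrow> l) (filter_of_ultrafilter S U)"
proof -
  \<comment> \<open>A point \<open>s\<close> on the correct side of every rational cut has the limit as its value.\<close>
  define L where "L q = {s \<in> S. \<phi> s < q}" for q
  define D where "D q = (if L q \<in> U then L q else S - L q)" for q
  have D: "D q \<in> U" for q
  proof -
    have "L q \<subseteq> S" by (auto simp: L_def)
    then have "L q \<in> U \<or> S - L q \<in> U"
      using U unfolding ultrafilter_on_def by blast
    then show ?thesis by (auto simp: D_def)
  qed
  then have "D ` \<rat> \<subseteq> U" "countable (D ` \<rat>)"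
    using countable_rat by auto
  then have "\<Inter>(D ` \<rat>) \<noteq> {}"
    using cip unfolding countable_intersection_property_def by blast
  then obtain s where s: "\<And>q. q \<in> \<rat> \<Longrightarrow> s \<in> D q" by blast
  have sub: "B \<in> U" if "A \<in> U" "A \<subseteq> B" "B \<subseteq> S" for A B
    using U that unfolding ultrafilter_on_def by blast
  have "(\<phi> \<longlongrightarrow> \<phi> s) (filter_of_ultrafilter S U)"
  proof (rule order_tendstoI)
    fix a assume "a < \<phi> s"
    then obtain q where q: "q \<in> \<rat>" "a < q" "q < \<phi> s" using Rats_dense_in_real by blast
    then have "s \<notin> L q" "s \<in> D q" using s by (auto simp: L_def)
    then have "S - L q \<in> U"
      using D[of q] by (auto simp: D_def split: if_splits)
    moreover have "S - L q \<subseteq> {s \<in> S. a < \<phi> s}" using q(2) by (auto simp: L_def)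
    ultimately show "\<forall>\<^sub>F x in filter_of_ultrafilter S U. a < \<phi> x"
      unfolding eventually_filter_of_ultrafilter[OF U] by (rule sub) auto
  next
    fix a assume "\<phi> s < a"
    then obtain q where q: "q \<in> \<rat>" "\<phi> s < q" "q < a" using Rats_dense_in_real by blast
    then have "s \<in> D q" using s by blast
    then have "L q \<in> U"
      using q(2) by (auto simp: D_def L_def split: if_splits)
    moreover have "L q \<subseteq> {s \<in> S. \<phi> s < a}" using q(3) by (auto simp: L_def)
    ultimately show "\<forall>\<^sub>F x in filter_of_ultrafilter S U. \<phi> x < a"
      unfolding eventually_filter_of_ultrafilter[OF U] by (rule sub) auto
  qed
  then show thesis by (rule that)
qed

section \<open>Open partitions of realcompact spaces and the characterization\<close>

lemma realcompact_imp_not_Ulam_measurable: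
  assumes X: "realcompact_space X" and P: "open_partition X P"
  shows "\<not> Ulam_measurable |P|"
proof
  assume "Ulam_measurable |P|"
  then obtain S :: "'a set set" and U where S: "|S| =o |P|" and U: "ultrafilter_on S U"
    and free: "\<Inter>U = {}" and cip: "countable_intersection_property U"
    unfolding Ulam_measurable_def by blast
  obtain b where b: "bij_betw b S P"
    using S card_of_ordIso by blast
  have UP: "\<Union>P = topspace X" and disj: "\<And>A B. A \<in> P \<Longrightarrow> B \<in> P \<Longrightarrow> A \<noteq> B \<Longrightarrow> A \<inter> B = {}"
    and ne: "\<And>A. A \<in> P \<Longrightarrow> A \<noteq> {}" and opn: "\<And>A. A \<in> P \<Longrightarrow> openin X A"
    using P by (auto simp: open_partition_def partition_on_def disjoint_def)
  define pt where "pt s = (SOME x. x \<in> b s)" for s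
  have bP: "b s \<in> P" if "s \<in> S" for s
    using b that by (auto simp: bij_betw_def)
  have pt: "pt s \<in> b s" if "s \<in> S" for s
    using ne[OF bP[OF that]] unfolding pt_def by (simp add: some_in_eq)
  define F where "F = filtermap pt (filter_of_ultrafilter S U)"
  have evF: "eventually Q F \<longleftrightarrow> {s \<in> S. Q (pt s)} \<in> U" for Q
    by (simp add: F_def eventually_filtermap eventually_filter_of_ultrafilter[OF U])
  have "functionally_convergent X F"
    unfolding functionally_convergent_def
  proof (intro conjI allI impI)
    show "F \<noteq> bot"
      unfolding trivial_limit_def evF using U by (simp add: ultrafilter_on_def)
    have "pt s \<in> topspace X" if "s \<in> S" for s
      using pt[OF that] bP[OF that] UP by blast
    then have "{s \<in> S. pt s \<in> topspace X} = S" by blast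
    then show "F \<le> principal (topspace X)"
      unfolding le_principal evF using U by (simp add: ultrafilter_on_def)
    fix f :: "'a \<Rightarrow> real"
    obtain l where "((\<lambda>s. f (pt s)) \<longlongrightarrow> l) (filter_of_ultrafilter S U)"
      using countably_complete_ultrafilter_real_limit[OF U cip] by blast
    then show "\<exists>l. (f \<longlongrightarrow> l) F"
      by (auto simp: F_def filterlim_filtermap)
  qed
  then obtain x where x: "limitin X (\<lambda>y. y) x F"
    using realcompact_limit[OF X] by blast
  then have "x \<in> \<Union>P" using UP by (simp add: limitin_topspace)
  then obtain A where A: "A \<in> P" "x \<in> A" by blast
  then have ev: "{s \<in> S. pt s \<in> A} \<in> U"
    using limitinD[OF x opn] unfolding evF by blast
  obtain s where s: "s \<in> S" "b s = A"
    using b A(1) by (auto simp: bij_betw_def)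
  have "t = s" if "t \<in> S" "pt t \<in> A" for t
  proof -
    have "b t = b s" using disj[OF bP[OF that(1)] A(1)] pt[OF that(1)] that(2) s(2) by blast
    then show ?thesis using b that(1) s(1) by (auto simp: bij_betw_def inj_on_def)
  qed
  moreover obtain B where "B \<in> U" "s \<notin> B" using free by blast
  ultimately have "{s \<in> S. pt s \<in> A} \<inter> B = {}" by blast
  moreover have "{s \<in> S. pt s \<in> A} \<inter> B \<in> U"
    using U ev \<open>B \<in> U\<close> unfolding ultrafilter_on_def by blast
  ultimately show False using U by (simp add: ultrafilter_on_def)
qed

theorem corollary3p1p26:
  fixes X :: "'a topology"
  assumes "Tychonoff_space X"
  shows "realcompact_space X \<longleftrightarrow>
    delta_complete X \<and> \<not> (\<exists>P. open_partition X P \<and> Ulam_measurable |P| )"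
proof
  assume X: "realcompact_space X"
  have "\<exists>x\<in>topspace X. limitin X (\<lambda>y. y) x F"
    if "Cauchy_filter_on (topspace X) (star_finite_uniformity X (fine_uniformity X)) F" for F
    using realcompact_limit[OF X Cauchy_imp_functionally_convergent[OF assms that]]
      limitin_topspace by metis
  then have "delta_complete X"
    by (simp add: delta_complete_def complete_uniformity_def
        uniform_topology_star_finite_uniformity[OF assms])
  with X show "delta_complete X \<and> \<not> (\<exists>P. open_partition X P \<and> Ulam_measurable |P| )"
    using realcompact_imp_not_Ulam_measurable by blast
next
  assume R: "delta_complete X \<and> \<not> (\<exists>P. open_partition X P \<and> Ulam_measurable |P| )"
  show "realcompact_space X"
  proof (rule realcompact_spaceI[OF assms])
    fix F assume "functionally_convergent X F"
    then have "Cauchy_filter_on (topspace X) (star_finite_uniformity X (fine_uniformity X)) F"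
      using functionally_convergent_imp_Cauchy[OF assms] R by blast
    then show "\<exists>x. limitin X (\<lambda>y. y) x F"
      using R by (auto simp: delta_complete_def complete_uniformity_def
          uniform_topology_star_finite_uniformity[OF assms])
  qed
qed

end
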